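(* Let $\phi$ be a spherically symmetric solution to $\Box_g\phi=0$ on $\mathcal R$ whose initial data satisfy the data bounds with some constant $D>0$ and the limit condition, and such that $\mathfrak L\neq0$. Then for every $\epsilon>0$, the following holds along the event horizon: $$\int_{\mathcal H^+\cap\{v\ge1\}}v^{7+\epsilon}(\partial_v\phi)^2=\infty.$$
   Context: Fix $0<|e|<M$, let $r_\pm=M\pm\sqrt{M^2-e^2}$, $F(r)=1-\frac{2M}{r}+\frac{e^2}{r^2}$. On the exterior region $\{r>r_+\}$ and on the black hole interior $\{r_-<r<r_+\}$ the Reissner–Nordström metric is $g=-F\,dt^2+F^{-1}dr^2+r^2d\sigma_{\mathbb S^2}$. Put $r^*=r+\big(M+\frac{2M^2-e^2}{2\sqrt{M^2-e^2}}\big)\log|r-r_+|+\big(M-\frac{2M^2-e^2}{2\sqrt{M^2-e^2}}\big)\log|r-r_-|$. Exterior null coordinates: $v=\frac12(t+r^* )$, $u=\frac12(t-r^* )$, $\Omega^2=F$, $\partial_v r=-\partial_u r=\Omega^2$; future null infinity is $\{v=\infty\}$, the event horizon $\mathcal H^+$ is $\{u=+\infty\}$. Interior null coordinates: $v=\frac12(r^*+t)$, $u=\frac12(r^*-t)$, $\Omega^2=-F$, $\partial_v r=\partial_u r=-\Omega^2$; $\mathcal H^+$ is $\{u=-\infty\}$. In both regions $g=-4\Omega^2du\,dv+r^2d\sigma_{\mathbb S^2}$. The two regions are glued smoothly along $\mathcal H^+=\{r=r_+\}$ using coordinates $(v,r)$, in which $g=-4F\,dv^2+4\,dv\,dr+r^2d\sigma_{\mathbb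 S^2}$. For spherically symmetric $\phi$, $\Box_g\phi=0$ reads $\partial_u\partial_v\phi=-\frac{\partial_v r\,\partial_u\phi}{r}-\frac{\partial_u r\,\partial_v\phi}{r}$. Solutions are real-valued, $C^1$ (including across $\mathcal H^+$), with continuous $\partial_u\partial_v\phi$. Fix $U_0>0$. $\mathcal R$ is the union of the exterior set $\{u\ge -U_0,\ v\ge1\}$, $\mathcal H^+\cap\{v\ge1\}$, and the interior set $\{u\le-1,\ v\ge1\}$. Data bounds with constant $D$: on the exterior hypersurface $\{u=-U_0,\ v\ge1\}$, $r^2\big|\frac{\partial_v\phi}{\partial_v r}\big|\le D$ and $r^3\big|\frac{\partial_v(r\phi)}{\partial_v r}\big|\le D$; on the hypersurface $\{v=1\}$, restricted to $u\ge -U_0$ in the exterior and $u\le -1$ in the interior, $\big|\frac{\partial_u\phi}{\partial_u r}\big|\le D$ and $\big|\frac{\partial_u(r\phi)}{\partial_u r}\big|\le D$. Limit condition: $\lim_{v\to\infty}r^3\partial_v(r\phi)(-U_0,v)$ exists (exterior). $\mathfrak L:=\lim_{v\to\infty} r^3\partial_v(r\phi)(-U_0,v)-\int_{-U_0}^\infty 2M\Phi(u)\,du$ with $\Phi(u):=\lim_{v\to\infty}r\phi(u,v)$ (exterior; this limit exists for every spherically symmetric solution $\phi$ to $\Box_g\phi=0$ on $\mathcal R$ satisfying the data bounds with some constant $D>0$ and the limit condition). The integral over $\mathcal H^+$ is with respect to $dv$; on $\mathcal H^+$, $\partial_v\phi$ is the limit of the exterior null-coordinate derivative as $u\to\infty$.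 *)

theory Defs
  imports "HOL-Analysis.Analysis"
begin

definition rplus :: "real \<Rightarrow> real \<Rightarrow> real" where
  "rplus M e = M + sqrt (M\<^sup>2 - e\<^sup>2)"

definition rminus :: "real \<Rightarrow> real \<Rightarrow> real" where
  "rminus M e = M - sqrt (M\<^sup>2 - e\<^sup>2)"

definition rstar :: "real \<Rightarrow> real \<Rightarrow> real \<Rightarrow> real" where
  "rstar M e r = r
     + (M + (2 * M\<^sup>2 - e\<^sup>2) / (2 * sqrt (M\<^sup>2 - e\<^sup>2))) * ln \<bar>r - rplus M e\<bar>
     + (M - (2 * M\<^sup>2 - e\<^sup>2) / (2 * sqrt (M\<^sup>2 - e\<^sup>2))) * ln \<bar>r - rminus M e\<bar>"

text \<open>
  With \<open>F = 1 - 2 * M / r + e\<^sup>2 / r\<^sup>2\<close> one has \<open>d rstar / d r = 1 / F\<close>, so \<open>rstar\<close> is a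
  bijection onto the reals on \<open>{rplus<..}\<close> (increasing) and on \<open>{rminus<..<rplus}\<close> (decreasing).
  In the exterior \<open>v = (t + rstar) / 2\<close> and \<open>u = (t - rstar) / 2\<close>, i.e. \<open>rstar = v - u\<close>; in the
  interior \<open>v = (rstar + t) / 2\<close> and \<open>u = (rstar - t) / 2\<close>, i.e. \<open>rstar = u + v\<close>. The area radius
  as a function of \<open>(u, v)\<close> is obtained by inverting these relations; it satisfies
  \<open>\<partial>\<^sub>v r = - \<partial>\<^sub>u r = F\<close> in the exterior and \<open>\<partial>\<^sub>v r = \<partial>\<^sub>u r = F\<close> in the interior.
\<close>

definition r_ext :: "real \<Rightarrow> real \<Rightarrow> real \<Rightarrow> real \<Rightarrow> real" where
  "r_ext M e u v = inv_into {rplus M e<..} (rstar M e) (v - u)"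

definition r_int :: "real \<Rightarrow> real \<Rightarrow> real \<Rightarrow> real \<Rightarrow> real" where
  "r_int M e u v = inv_into {rminus M e<..<rplus M e} (rstar M e) (u + v)"

text \<open>
  The spherical quotient of the region, as a set of pairs \<open>(v, r)\<close>: these are regular coordinates
  across the event horizon \<open>r = rplus\<close>. A spherically symmetric function is a function on this
  quotient.
\<close>

definition region :: "real \<Rightarrow> real \<Rightarrow> real \<Rightarrow> (real \<times> real) set" where
  "region M e U0 =
     {(v, r). r > rplus M e \<and> v - rstar M e r \<ge> - U0 \<and> v \<ge> 1}
   \<union> {(v, r). r = rplus M e \<and> v \<ge> 1}
   \<union> {(v, r). rminus M e < r \<and> r < rplus M e \<and> rstar M e r - v \<le> - 1 \<and> v \<ge> 1}"

definition phi_ext :: "real \<Rightarrow> real \<Rightarrow> (real \<times> real \<Rightarrow> real) \<Rightarrow> real \<Rightarrow> real \<Rightarrow> real" where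
  "phi_ext M e \<phi> u v = \<phi> (v, r_ext M e u v)"

definition phi_int :: "real \<Rightarrow> real \<Rightarrow> (real \<times> real \<Rightarrow> real) \<Rightarrow> real \<Rightarrow> real \<Rightarrow> real" where
  "phi_int M e \<phi> u v = \<phi> (v, r_int M e u v)"

text \<open>
  Null-coordinate derivatives on \<open>U \<times> {1..}\<close>, where \<open>U\<close> is \<open>{-U0..}\<close> (exterior) or \<open>{..-1}\<close>
  (interior). They are ordinary partial derivatives inside and one-sided on the boundary.
\<close>

definition d_u :: "real set \<Rightarrow> (real \<Rightarrow> real \<Rightarrow> real) \<Rightarrow> real \<Rightarrow> real \<Rightarrow> real" where
  "d_u U f u v = vector_derivative (\<lambda>u'. f u' v) (at u within U)"

definition d_v :: "(real \<Rightarrow> real \<Rightarrow> real) \<Rightarrow> real \<Rightarrow> real \<Rightarrow> real" where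
  "d_v f u v = vector_derivative (\<lambda>v'. f u v') (at v within {1..})"

definition C1_on :: "('a::real_normed_vector \<Rightarrow> real) \<Rightarrow> 'a set \<Rightarrow> bool" where
  "C1_on f S \<longleftrightarrow>
     (\<exists>f'. (\<forall>p\<in>S. (f has_derivative blinfun_apply (f' p)) (at p within S)) \<and> continuous_on S f')"

text \<open>
  \<open>\<psi>\<close> has a continuous mixed derivative \<open>\<partial>\<^sub>u \<partial>\<^sub>v \<psi>\<close> (called \<open>w\<close>) on \<open>U \<times> {1..}\<close> and satisfies the
  spherically symmetric wave equation there, \<open>\<rho>\<close> being the area radius.
\<close>

definition null_wave ::
    "real set \<Rightarrow> (real \<Rightarrow> real \<Rightarrow> real) \<Rightarrow> (real \<Rightarrow> real \<Rightarrow> real) \<Rightarrow> bool" where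
  "null_wave U \<rho> \<psi> \<longleftrightarrow>
     (\<exists>w. continuous_on (U \<times> {1..}) w \<and>
       (\<forall>u\<in>U. \<forall>v\<in>{1..}.
          ((\<lambda>u'. d_v \<psi> u' v) has_real_derivative w (u, v)) (at u within U) \<and>
          w (u, v) = - (d_v \<rho> u v * d_u U \<psi> u v) / \<rho> u v - (d_u U \<rho> u v * d_v \<psi> u v) / \<rho> u v))"

text \<open>
  On the horizon itself, where \<open>u\<close> is not a coordinate, nothing needs to be imposed beyond
  \<open>C\<^sup>1\<close> regularity in \<open>(v, r)\<close>: dividing the equation by \<open>\<partial>\<^sub>u r\<close> and passing to the limit from
  either side gives the wave equation at \<open>r = rplus\<close>.
\<close>

definition wave_solution :: "real \<Rightarrow> real \<Rightarrow> real \<Rightarrow> (real \<times> real \<Rightarrow> real) \<Rightarrow> bool" where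
  "wave_solution M e U0 \<phi> \<longleftrightarrow>
     C1_on \<phi> (region M e U0) \<and>
     null_wave {- U0..} (r_ext M e) (phi_ext M e \<phi>) \<and>
     null_wave {..- 1} (r_int M e) (phi_int M e \<phi>)"

definition rphi_ext :: "real \<Rightarrow> real \<Rightarrow> (real \<times> real \<Rightarrow> real) \<Rightarrow> real \<Rightarrow> real \<Rightarrow> real" where
  "rphi_ext M e \<phi> u v = r_ext M e u v * phi_ext M e \<phi> u v"

definition rphi_int :: "real \<Rightarrow> real \<Rightarrow> (real \<times> real \<Rightarrow> real) \<Rightarrow> real \<Rightarrow> real \<Rightarrow> real" where
  "rphi_int M e \<phi> u v = r_int M e u v * phi_int M e \<phi> u v"

definition data_bounds ::
    "real \<Rightarrow> real \<Rightarrow> real \<Rightarrow> (real \<times> real \<Rightarrow> real) \<Rightarrow> real \<Rightarrow> bool" where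
  "data_bounds M e U0 \<phi> D \<longleftrightarrow>
     (\<forall>v\<ge>1.
        (r_ext M e (- U0) v)^2
          * \<bar>d_v (phi_ext M e \<phi>) (- U0) v / d_v (r_ext M e) (- U0) v\<bar> \<le> D \<and>
        (r_ext M e (- U0) v)^3
          * \<bar>d_v (rphi_ext M e \<phi>) (- U0) v / d_v (r_ext M e) (- U0) v\<bar> \<le> D) \<and>
     (\<forall>u\<ge>- U0.
        \<bar>d_u {- U0..} (phi_ext M e \<phi>) u 1 / d_u {- U0..} (r_ext M e) u 1\<bar> \<le> D \<and>
        \<bar>d_u {- U0..} (rphi_ext M e \<phi>) u 1 / d_u {- U0..} (r_ext M e) u 1\<bar> \<le> D) \<and>
     (\<forall>u\<le>- 1.
        \<bar>d_u {..- 1} (phi_int M e \<phi>) u 1 / d_u {..- 1} (r_int M e) u 1\<bar> \<le> D \<and>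
        \<bar>d_u {..- 1} (rphi_int M e \<phi>) u 1 / d_u {..- 1} (r_int M e) u 1\<bar> \<le> D)"

definition data_at_infinity ::
    "real \<Rightarrow> real \<Rightarrow> real \<Rightarrow> (real \<times> real \<Rightarrow> real) \<Rightarrow> real \<Rightarrow> real" where
  "data_at_infinity M e U0 \<phi> v = (r_ext M e (- U0) v)^3 * d_v (rphi_ext M e \<phi>) (- U0) v"

definition limit_condition :: "real \<Rightarrow> real \<Rightarrow> real \<Rightarrow> (real \<times> real \<Rightarrow> real) \<Rightarrow> bool" where
  "limit_condition M e U0 \<phi> \<longleftrightarrow> (\<exists>l. (data_at_infinity M e U0 \<phi> \<longlongrightarrow> l) at_top)"

definition radiation_field ::
    "real \<Rightarrow> real \<Rightarrow> (real \<times> real \<Rightarrow> real) \<Rightarrow> real \<Rightarrow> real" where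
  "radiation_field M e \<phi> u = Lim at_top (\<lambda>v. rphi_ext M e \<phi> u v)"

definition frakL :: "real \<Rightarrow> real \<Rightarrow> real \<Rightarrow> (real \<times> real \<Rightarrow> real) \<Rightarrow> real" where
  "frakL M e U0 \<phi> =
     Lim at_top (data_at_infinity M e U0 \<phi>)
     - (LINT u:{- U0..}|lborel. 2 * M * radiation_field M e \<phi> u)"

definition d_v_horizon :: "real \<Rightarrow> real \<Rightarrow> (real \<times> real \<Rightarrow> real) \<Rightarrow> real \<Rightarrow> real" where
  "d_v_horizon M e \<phi> v = Lim at_top (\<lambda>u. d_v (phi_ext M e \<phi>) u v)"

end

theory Submission
  imports Defs
begin

text \<open>
  Only the exterior matters. With \<open>\<psi> = r \<phi>\<close> the wave equation is \<open>\<partial>\<^sub>u \<partial>\<^sub>v \<psi> = - V \<psi>\<close> with \<open>V \<ge> 0\<close>, and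
  \<open>\<psi> = r\<close> is itself a solution. Suppose the integral is finite and put \<open>\<alpha> = 3 + \<epsilon> / 2\<close>. Then \<open>\<phi>\<close>
  converges along the horizon to some \<open>\<phi>\<^sub>0\<close> at rate \<open>v powr (- \<alpha>)\<close>. Solving the equation sideways, from
  the horizon and \<open>{v = 1}\<close> towards decreasing \<open>u\<close>, and comparing with the supersolution \<open>r w (min u v)\<close>,
  \<open>w t = (t + T) powr (- \<alpha>)\<close>, gives \<open>|\<phi> - \<phi>\<^sub>0| \<le> K w (min u v)\<close> everywhere, hence
  \<open>|\<partial>\<^sub>u (\<psi> - \<phi>\<^sub>0 r)| \<le> K\<^sub>1 w u\<close> and \<open>|\<psi> - \<phi>\<^sub>0 r| \<le> K\<^sub>2 (u + T) powr (1 - \<alpha>)\<close> for \<open>u \<le> v\<close>. The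
  data bounds force \<open>\<phi>\<^sub>0 = 0\<close>. Integrating the equation in \<open>u\<close> from the initial cone to the diagonal
  \<open>u = v\<close>, dominated convergence shows that \<open>r\<^sup>3 \<partial>\<^sub>v \<psi>\<close> on the diagonal tends to \<open>frakL\<close>, with \<open>r\<close>
  evaluated on the initial cone. So the derivative of \<open>v \<mapsto> \<psi> v v\<close> is \<open>frakL / v\<^sup>3 + o(1 / v\<^sup>3)\<close>, while
  \<open>\<psi> v v = O(v powr (- \<alpha>))\<close> with \<open>\<alpha> > 2\<close>; this forces \<open>frakL = 0\<close>.
\<close>

subsection \<open>Calculus on half-lines\<close>

text \<open>Both \<open>h - g\<close> and \<open>h + g\<close> are nondecreasing. This comparison
  replaces integration of \<bar>g'\<bar>: the estimates below only have to exhibit an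
  \<open>h\<close> with a large enough derivative.\<close>

lemma abs_diff_le_of_deriv:
  fixes g h :: "real \<Rightarrow> real"
  assumes "a \<le> b"
    and g: "\<And>x. x \<in> {a..b} \<Longrightarrow> (g has_real_derivative g' x) (at x within {a..b})"
    and h: "\<And>x. x \<in> {a..b} \<Longrightarrow> (h has_real_derivative h' x) (at x within {a..b})"
    and le: "\<And>x. a < x \<Longrightarrow> x < b \<Longrightarrow> \<bar>g' x\<bar> \<le> h' x"
  shows "\<bar>g b - g a\<bar> \<le> h b - h a"
proof -
  have dg: "(g has_real_derivative g' x) (at x)" and dh: "(h has_real_derivative h' x) (at x)"
    if "a < x" "x < b" for x
    using g[of x] h[of x] that by (auto simp: at_within_Icc_at)
  have cg: "continuous_on {a..b} g" and ch: "continuous_on {a..b} h"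
    using g h by (blast intro: DERIV_continuous_on)+
  have "h a - g a \<le> h b - g b"
  proof (rule DERIV_nonneg_imp_increasing_open[OF \<open>a \<le> b\<close>])
    fix x assume x: "a < x" "x < b"
    have "((\<lambda>x. h x - g x) has_real_derivative h' x - g' x) (at x)"
      using dg[OF x] dh[OF x] by (intro derivative_intros)
    with le[OF x] show "\<exists>y. ((\<lambda>x. h x - g x) has_real_derivative y) (at x) \<and> 0 \<le> y"
      by (intro exI[of _ "h' x - g' x"]) auto
  qed (intro continuous_intros cg ch)
  moreover have "h a + g a \<le> h b + g b"
  proof (rule DERIV_nonneg_imp_increasing_open[OF \<open>a \<le> b\<close>])
    fix x assume x: "a < x" "x < b"
    have "((\<lambda>x. h x + g x) has_real_derivative h' x + g' x) (at x)"
      using dg[OF x] dh[OF x] by (intro derivative_intros)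
    with le[OF x] show "\<exists>y. ((\<lambda>x. h x + g x) has_real_derivative y) (at x) \<and> 0 \<le> y"
      by (intro exI[of _ "h' x + g' x"]) auto
  qed (intro continuous_intros cg ch)
  ultimately show ?thesis by linarith
qed

text \<open>The bound makes the image filter of \<open>at_top\<close> Cauchy, so completeness of the
  reals gives a limit; letting \<open>y\<close> tend to infinity in the bound gives the
  rate.\<close>

lemma convergent_of_cauchy_bound:
  fixes g \<eta> :: "real \<Rightarrow> real"
  assumes bd: "\<And>x y. a \<le> x \<Longrightarrow> x \<le> y \<Longrightarrow> \<bar>g y - g x\<bar> \<le> \<eta> x"
    and \<eta>: "(\<eta> \<longlongrightarrow> 0) at_top"
  obtains L where "(g \<longlongrightarrow> L) at_top" "\<And>x. a \<le> x \<Longrightarrow> \<bar>L - g x\<bar> \<le> \<eta> x"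
proof -
  have "cauchy_filter (filtermap g at_top)"
    unfolding cauchy_filter_metric_filtermap
  proof (intro allI impI)
    fix d :: real assume "d > 0"
    then obtain N where N: "\<And>x. x \<ge> N \<Longrightarrow> \<eta> x < d"
      using order_tendstoD(2)[OF \<eta>, of d] by (auto simp: eventually_at_top_linorder)
    have main: "dist (g x) (g y) < d" if "x \<ge> max a N" "x \<le> y" for x y
      using bd[of x y] N[of x] that by (auto simp: dist_real_def)
    have "dist (g x) (g y) < d" if "x \<ge> max a N" "y \<ge> max a N" for x y
      using main[of x y] main[of y x] that by (cases "x \<le> y") (auto simp: dist_commute)
    then show "\<exists>P. eventually P at_top \<and> (\<forall>x y. P x \<and> P y \<longrightarrow> dist (g x) (g y) < d)"
      by (intro exI[of _ "\<lambda>x. x \<ge> max a N"]) (auto intro: eventually_ge_at_top simp del: max.bounded_iff)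
  qed
  then obtain L where L: "(g \<longlongrightarrow> L) at_top"
    using complete_uniform[of "UNIV :: real set"] complete_UNIV filtermap_bot_iff[of g at_top]
    unfolding filterlim_def by (metis UNIV_I top_greatest principal_UNIV trivial_limit_at_top_linorder)
  moreover have "\<bar>L - g x\<bar> \<le> \<eta> x" if "a \<le> x" for x
  proof (rule tendsto_upperbound)
    show "((\<lambda>y. \<bar>g y - g x\<bar>) \<longlongrightarrow> \<bar>L - g x\<bar>) at_top" by (intro tendsto_intros L)
    show "\<forall>\<^sub>F y in at_top. \<bar>g y - g x\<bar> \<le> \<eta> x"
      using eventually_ge_at_top[of x] by eventually_elim (use bd that in auto)
  qed simp
  ultimately show ?thesis using that by blast
qed

text \<open>This is what makes one-sided derivatives unique, also at the boundary point.\<close>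

lemma at_within_Ici_neq_bot: "a \<le> x \<Longrightarrow> at x within {a..} \<noteq> (bot :: real filter)"
  using at_le[of "{x<..}" "{a..}" x] trivial_limit_at_right_real[of x] bot.extremum_uniqueI by force

lemma reflect_at_bot: "filterlim (\<lambda>u. v - u) at_bot at_top" for v :: real
  unfolding filterlim_at_bot
proof
  fix Z
  show "\<forall>\<^sub>F u in at_top. v - u \<le> Z"
    using eventually_ge_at_top[of "v - Z"] by eventually_elim simp
qed

lemma shift_at_top: "filterlim (\<lambda>x. x - u) at_top at_top" for u :: real
  unfolding filterlim_at_top
proof
  fix Z
  show "\<forall>\<^sub>F x in at_top. Z \<le> x - u"
    using eventually_ge_at_top[of "Z + u"] by eventually_elim simp
qed

subsection \<open>The area radius of the exterior\<close>

locale reissner_nordstrom =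
  fixes M e :: real
  assumes e_pos: "0 < \<bar>e\<bar>" and e_less: "\<bar>e\<bar> < M"
begin

abbreviation "rp \<equiv> rplus M e"
abbreviation "rm \<equiv> rminus M e"

definition F :: "real \<Rightarrow> real" where "F r = 1 - 2 * M / r + e\<^sup>2 / r\<^sup>2"
definition dF :: "real \<Rightarrow> real" where "dF r = 2 * M / r\<^sup>2 - 2 * e\<^sup>2 / r^3"
text \<open>In the exterior v - u is the tortoise coordinate, so radius, metric coefficient and
  potential are functions of the single variable x = v - u. The function \<open>f\<close> is also
  the derivative of \<open>\<rho>\<close>.\<close>

definition \<rho> :: "real \<Rightarrow> real" where "\<rho> x = inv_into {rp<..} (rstar M e) x"
definition f :: "real \<Rightarrow> real" where "f x = F (\<rho> x)"
definition f' :: "real \<Rightarrow> real" where "f' x = f x * dF (\<rho> x)"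
text \<open>The potential in the wave equation for r\<phi>. The identity
  \<open>V x * \<rho> x = f' x\<close> expresses that the radius itself solves that
  equation.\<close>

definition V :: "real \<Rightarrow> real" where "V x = f' x / \<rho> x"

section \<open>The horizon radii and the metric coefficient\<close>

lemma e2_less: "e\<^sup>2 < M\<^sup>2" and e2_pos: "0 < e\<^sup>2" and M_pos: "0 < M"
  using e_pos e_less abs_le_square_iff[of M e] by auto

lemma sqrt_pos: "0 < sqrt (M\<^sup>2 - e\<^sup>2)" "(sqrt (M\<^sup>2 - e\<^sup>2))\<^sup>2 = M\<^sup>2 - e\<^sup>2"
  using e2_less by auto

lemma rp_rm: "rp + rm = 2 * M" "rp * rm = e\<^sup>2"
  using sqrt_pos by (auto simp: rplus_def rminus_def algebra_simps power2_eq_square)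

lemma rp_ge: "M < rp" using sqrt_pos by (simp add: rplus_def)
lemma rp_pos: "0 < rp" using rp_ge M_pos by simp
lemma rm_pos: "0 < rm" using rp_rm(2) e2_pos rp_pos by (metis zero_less_mult_pos)
lemma rm_less: "rm < rp" using sqrt_pos by (simp add: rplus_def rminus_def)
text \<open>This strict inequality makes \<open>dF\<close> positive at r = \<open>rp\<close>: the
  horizon has positive surface gravity, the source of the red-shift.\<close>

lemma e2_less_Mrp: "e\<^sup>2 < M * rp"
  using mult_strict_left_mono[OF rp_ge M_pos] e2_less by (simp add: power2_eq_square)

lemma F_factor: "r \<noteq> 0 \<Longrightarrow> F r = (r - rp) * (r - rm) / r\<^sup>2"
proof -
  assume "r \<noteq> 0"
  have "(r - rp) * (r - rm) = r\<^sup>2 - (rp + rm) * r + rp * rm"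
    by (simp add: algebra_simps power2_eq_square)
  also have "\<dots> = r\<^sup>2 - 2 * M * r + e\<^sup>2" by (simp add: rp_rm)
  finally show ?thesis using \<open>r \<noteq> 0\<close> by (simp add: F_def field_simps power2_eq_square)
qed

lemma F_pos: "rp < r \<Longrightarrow> 0 < F r"
  using rp_pos rm_less by (simp add: F_factor)

lemma F_le_1: "rp \<le> r \<Longrightarrow> F r \<le> 1"
proof -
  assume r: "rp \<le> r"
  have "e\<^sup>2 \<le> M * r" using e2_less_Mrp mult_left_mono[OF r, of M] M_pos by linarith
  then have "e\<^sup>2 \<le> 2 * M * r" using mult_nonneg_nonneg[of M r] M_pos rp_pos r by linarith
  then have "(e\<^sup>2 - 2 * M * r) / r\<^sup>2 \<le> 0" by (intro divide_nonpos_nonneg) auto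
  moreover have "F r = 1 + (e\<^sup>2 - 2 * M * r) / r\<^sup>2"
    using r rp_pos by (simp add: F_def field_simps power2_eq_square)
  ultimately show ?thesis by linarith
qed

lemma dF_eq: "r \<noteq> 0 \<Longrightarrow> dF r = 2 * (M * r - e\<^sup>2) / r^3"
  by (simp add: dF_def field_simps power2_eq_square power3_eq_cube)

lemma dF_bounds: "rp \<le> r \<Longrightarrow> 0 \<le> dF r \<and> dF r \<le> 2 * M / r\<^sup>2"
proof -
  assume r: "rp \<le> r"
  have "e\<^sup>2 \<le> M * r" using e2_less_Mrp mult_left_mono[OF r, of M] M_pos by linarith
  moreover have "r > 0" using r rp_pos by simp
  ultimately have "0 \<le> dF r" using dF_eq[of r] by simp
  moreover have "dF r \<le> 2 * M / r\<^sup>2" using \<open>r > 0\<close> by (simp add: dF_def)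
  ultimately show ?thesis by simp
qed

lemma F_deriv: "r \<noteq> 0 \<Longrightarrow> (F has_real_derivative dF r) (at r)"
  unfolding F_def[abs_def] dF_def
  by (auto intro!: derivative_eq_intros simp: field_simps power2_eq_square power3_eq_cube)

text \<open>The logarithms in \<open>rstar\<close> carry the residues of 1 / F = r^2 / ((r - rp) (r
  - rm)) at its two poles.\<close>

lemma rstar_coeff:
  "M + (2 * M\<^sup>2 - e\<^sup>2) / (2 * sqrt (M\<^sup>2 - e\<^sup>2)) = rp\<^sup>2 / (rp - rm)"
  "M - (2 * M\<^sup>2 - e\<^sup>2) / (2 * sqrt (M\<^sup>2 - e\<^sup>2)) = - (rm\<^sup>2 / (rp - rm))"
proof -
  define s where "s = sqrt (M\<^sup>2 - e\<^sup>2)"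
  have s: "s > 0" and s2: "e\<^sup>2 = M\<^sup>2 - s\<^sup>2" using sqrt_pos by (auto simp: s_def)
  have "M + (2 * M\<^sup>2 - e\<^sup>2) / (2 * s) = (M + s)\<^sup>2 / (2 * s)"
    unfolding s2 using s by (simp add: field_simps power2_eq_square)
  then show "M + (2 * M\<^sup>2 - e\<^sup>2) / (2 * sqrt (M\<^sup>2 - e\<^sup>2)) = rp\<^sup>2 / (rp - rm)"
    by (simp add: rplus_def rminus_def flip: s_def)
  have "M - (2 * M\<^sup>2 - e\<^sup>2) / (2 * s) = - ((M - s)\<^sup>2 / (2 * s))"
    unfolding s2 using s by (simp add: field_simps power2_eq_square)
  then show "M - (2 * M\<^sup>2 - e\<^sup>2) / (2 * sqrt (M\<^sup>2 - e\<^sup>2)) = - (rm\<^sup>2 / (rp - rm))"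
    by (simp add: rplus_def rminus_def flip: s_def)
qed

section \<open>The tortoise coordinate as a bijection\<close>

lemma rstar_eq:
  "rp < r \<Longrightarrow> rstar M e r = r + rp\<^sup>2 / (rp - rm) * ln (r - rp) - rm\<^sup>2 / (rp - rm) * ln (r - rm)"
  unfolding rstar_def rstar_coeff using rm_less by simp

lemma rstar_deriv:
  assumes r: "rp < r"
  shows "(rstar M e has_real_derivative 1 / F r) (at r)"
proof -
  let ?g = "\<lambda>r. r + rp\<^sup>2 / (rp - rm) * ln (r - rp) - rm\<^sup>2 / (rp - rm) * ln (r - rm)"
  have "(?g has_real_derivative 1 + rp\<^sup>2 / (rp - rm) * (1 / (r - rp)) - rm\<^sup>2 / (rp - rm) * (1 / (r - rm))) (at r)"
    using r rm_less by (auto intro!: derivative_eq_intros simp: mult.commute)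
  moreover have "1 + rp\<^sup>2 / (rp - rm) * (1 / (r - rp)) - rm\<^sup>2 / (rp - rm) * (1 / (r - rm)) = 1 / F r"
  proof -
    have nz: "r - rp \<noteq> 0" "r - rm \<noteq> 0" "rp - rm \<noteq> 0" "r \<noteq> 0" using r rm_less rp_pos by auto
    \<comment> \<open>Partial fractions: with x = r - rp, y = r - rm and d = rp - rm, clearing
      denominators leaves this polynomial identity.\<close>
    have id: "(d * x * y + a * a * y - b * b * x) = d * r * r"
      if "x = r - a" "y = r - b" "d = a - b" for a b d x y :: real
      unfolding that by algebra
    from id[OF refl refl refl] show ?thesis
      using nz by (simp add: F_factor divide_simps power2_eq_square) (simp add: algebra_simps)
  qed
  ultimately have "(?g has_real_derivative 1 / F r) (at r)" by simp
  then show ?thesis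
    by (rule has_field_derivative_transform_within_open[of _ _ _ "{rp<..}"])
       (use r in \<open>auto simp: rstar_eq\<close>)
qed

text \<open>As 0 < F \<le> 1, the derivative 1 / F is at least 1. This yields injectivity, large
  values at large radii, and later the Lipschitz bound for \<open>\<rho>\<close>.\<close>

lemma rstar_growth: "rp < x \<Longrightarrow> x \<le> y \<Longrightarrow> y - x \<le> rstar M e y - rstar M e x"
proof -
  assume xy: "rp < x" "x \<le> y"
  have "\<bar>y - x\<bar> \<le> rstar M e y - rstar M e x"
  proof (rule abs_diff_le_of_deriv[where g' = "\<lambda>_. 1" and h' = "\<lambda>r. 1 / F r"])
    show "(rstar M e has_real_derivative 1 / F r) (at r within {x..y})" if "r \<in> {x..y}" for r
      using that xy by (intro has_field_derivative_at_within[OF rstar_deriv]) auto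
    show "\<bar>1::real\<bar> \<le> 1 / F r" if "x < r" "r < y" for r
      using that xy F_pos[of r] F_le_1[of r] by auto
  qed (use xy in auto)
  then show ?thesis using xy by simp
qed

lemma rstar_less_iff: "rp < x \<Longrightarrow> rp < y \<Longrightarrow> rstar M e x < rstar M e y \<longleftrightarrow> x < y"
  using rstar_growth[of x y] rstar_growth[of y x] by (cases x y rule: linorder_cases) auto

lemma rstar_inj: "inj_on (rstar M e) {rp<..}"
  by (rule inj_onI) (metis greaterThan_iff linorder_neq_iff rstar_less_iff)

lemma rstar_isCont: "rp < r \<Longrightarrow> isCont (rstar M e) r"
  using rstar_deriv DERIV_isCont by blast

lemma rstar_surj: "\<exists>r>rp. rstar M e r = x"
proof -
  define A where "A = rp\<^sup>2 / (rp - rm)"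
  have A: "A > 0" using rp_pos rm_less by (simp add: A_def)
  \<comment> \<open>On (rp, rp + 1] the part of \<open>rstar\<close> other than
    \<open>A * ln (r - rp)\<close> is at most \<open>B\<close>; \<open>y\<close> is then taken so
    small that \<open>A * ln y\<close> is at most \<open>x - B\<close>.\<close>
  define B where "B = rp + 1 - rm\<^sup>2 / (rp - rm) * ln (rp - rm)"
  define y where "y = min 1 (exp ((x - B) / A))"
  have y: "y > 0" "y \<le> 1" by (auto simp: y_def)
  have "ln y \<le> (x - B) / A" using ln_mono[of y "exp ((x - B) / A)"] y by (simp add: y_def)
  then have lny: "A * ln y \<le> x - B" using A by (simp add: field_simps)
  have "rstar M e (rp + y) \<le> x"
  proof -
    have "rm\<^sup>2 / (rp - rm) * ln (rp - rm) \<le> rm\<^sup>2 / (rp - rm) * ln (rp + y - rm)"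
      using y rm_less by (intro mult_left_mono) auto
    then have "rstar M e (rp + y) \<le> B + A * ln y"
      using y by (simp add: rstar_eq A_def B_def)
    then show ?thesis using lny by linarith
  qed
  \<comment> \<open>Far enough out for growth at unit rate to reach \<open>x\<close>.\<close>
  moreover define z where "z = rp + y + max 0 (x - rstar M e (rp + y))"
  have "rp + y \<le> z" by (simp add: z_def)
  moreover have "x \<le> rstar M e z"
    using rstar_growth[of "rp + y" z] y by (auto simp: z_def)
  ultimately have "\<exists>r. rp + y \<le> r \<and> r \<le> z \<and> rstar M e r = x"
    using y by (intro IVT) (auto intro!: rstar_isCont)
  then obtain r where "rp + y \<le> r" "rstar M e r = x" by blast
  with y show ?thesis by (intro exI[of _ r]) auto
qed

section \<open>The radius as a function of the tortoise coordinate\<close>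

lemma rho_gt: "rp < \<rho> x" and rstar_rho: "rstar M e (\<rho> x) = x"
proof -
  have "x \<in> rstar M e ` {rp<..}" using rstar_surj[of x] by auto
  from inv_into_into[OF this] f_inv_into_f[OF this]
  show "rp < \<rho> x" "rstar M e (\<rho> x) = x" by (auto simp: \<rho>_def)
qed

lemma rho_rstar: "rp < r \<Longrightarrow> \<rho> (rstar M e r) = r"
  unfolding \<rho>_def by (rule inv_into_f_f[OF rstar_inj]) simp

lemma rho_pos: "0 < \<rho> x" using rho_gt[of x] rp_pos by simp

lemma rho_less_iff: "\<rho> x < \<rho> y \<longleftrightarrow> x < y"
  using rstar_less_iff[OF rho_gt rho_gt, of x y] by (simp add: rstar_rho)

lemma rho_le_iff: "\<rho> x \<le> \<rho> y \<longleftrightarrow> x \<le> y"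
  using rho_less_iff[of y x] by (simp flip: not_less)

lemma rho_less_iff_rstar: "rp < r \<Longrightarrow> \<rho> x < r \<longleftrightarrow> x < rstar M e r"
  using rho_less_iff[of x "rstar M e r"] rho_rstar by simp

lemma f_pos: "0 < f x" and f_le_1: "f x \<le> 1"
  using F_pos[OF rho_gt] F_le_1 rho_gt[of x] by (auto simp: f_def)

lemma rho_deriv: "(\<rho> has_real_derivative f x) (at x)"
proof -
  have "isCont \<rho> (rstar M e (\<rho> x))"
  proof (rule isCont_inverse_function2[where f = "rstar M e" and x = "\<rho> x" and a = "(rp + \<rho> x) / 2" and b = "\<rho> x + 1"])
    fix z assume "(rp + \<rho> x) / 2 \<le> z"
    then have "rp < z" using rho_gt[of x] by (auto simp: field_simps)
    then show "\<rho> (rstar M e z) = z" "isCont (rstar M e) z"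
      using rho_rstar rstar_isCont by auto
  qed (use rho_gt[of x] in \<open>auto simp: field_simps\<close>)
  then have "isCont \<rho> x" by (simp add: rstar_rho)
  then have "(\<rho> has_real_derivative inverse (1 / F (\<rho> x))) (at x)"
    by (intro DERIV_inverse_function[of "rstar M e" _ _ _ "x - 1" "x + 1"] rstar_deriv rho_gt)
       (use F_pos[OF rho_gt, of x] in \<open>auto simp: rstar_rho\<close>)
  then show ?thesis by (simp add: f_def)
qed

lemma f_deriv: "(f has_real_derivative f' x) (at x)"
proof -
  have "((\<lambda>x. F (\<rho> x)) has_real_derivative dF (\<rho> x) * f x) (at x)"
    by (rule DERIV_chain2[OF F_deriv rho_deriv]) (use rho_pos[of x] in auto)
  then show ?thesis by (simp add: f_def[abs_def] f'_def mult.commute)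
qed

lemma f'_nonneg: "0 \<le> f' x"
  using f_pos[of x] dF_bounds[of "\<rho> x"] rho_gt[of x] by (simp add: f'_def)

lemma V_nonneg: "0 \<le> V x"
  using f'_nonneg rho_pos[of x] by (simp add: V_def)

lemma V_rho: "V x * \<rho> x = f' x" using rho_pos[of x] by (simp add: V_def)

lemma V_le: "V x \<le> 2 * M / \<rho> x ^ 3"
proof -
  have "f' x \<le> 1 * (2 * M / (\<rho> x)\<^sup>2)"
    unfolding f'_def using f_pos[of x] f_le_1[of x] dF_bounds[of "\<rho> x"] rho_gt[of x]
    by (intro mult_mono) auto
  then show ?thesis
    using rho_pos[of x] by (simp add: V_def divide_simps power2_eq_square power3_eq_cube mult.assoc)
qed

lemma continuous_on_rho: "continuous_on S \<rho>"
  using rho_deriv by (meson DERIV_isCont continuous_at_imp_continuous_on)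
lemma continuous_on_f: "continuous_on S f"
  using f_deriv by (meson DERIV_isCont continuous_at_imp_continuous_on)

lemma continuous_on_V: "continuous_on S V"
proof -
  have "continuous_on S (\<lambda>x. f x * dF (\<rho> x) / \<rho> x)"
    unfolding dF_def using rho_pos
    by (intro continuous_intros continuous_on_rho continuous_on_f) (auto simp: less_imp_neq[symmetric])
  then show ?thesis by (simp add: V_def[abs_def] f'_def)
qed

lemma f_mono: "x \<le> y \<Longrightarrow> f x \<le> f y"
  by (rule DERIV_nonneg_imp_nondecreasing) (use f_deriv f'_nonneg in blast)+

text \<open>Since \<open>f\<close> is nondecreasing, the radius has slope at least
  \<open>f 0\<close> on x \<ge> 0. Together with \<open>rho_diff\<close> this makes it comparable to
  x for large x.\<close>

lemma rho_lower: "0 \<le> x \<Longrightarrow> \<rho> 0 + f 0 * x \<le> \<rho> x"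
proof -
  assume x: "0 \<le> x"
  have "\<bar>f 0 * x - f 0 * 0\<bar> \<le> \<rho> x - \<rho> 0"
  proof (rule abs_diff_le_of_deriv[where g' = "\<lambda>_. f 0" and h' = f])
    show "((\<lambda>x. f 0 * x) has_real_derivative f 0) (at y within {0..x})" for y
      by (auto intro!: derivative_eq_intros)
    show "\<bar>f 0\<bar> \<le> f y" if "0 < y" for y
      using that f_pos[of 0] f_mono[of 0 y] by simp
  qed (use x in \<open>auto intro: has_field_derivative_at_within[OF rho_deriv]\<close>)
  then show ?thesis using x f_pos[of 0] by auto
qed

lemma rho_diff: "x \<le> y \<Longrightarrow> \<rho> y - \<rho> x \<le> y - x"
  using rstar_growth[OF rho_gt, of x "\<rho> y"] rho_le_iff[of x y] by (simp add: rstar_rho)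

lemma rho_at_top: "filterlim \<rho> at_top at_top"
proof (rule filterlim_at_top_mono)
  show "filterlim (\<lambda>x. \<rho> 0 + f 0 * x) at_top at_top"
    using f_pos[of 0] by (intro filterlim_tendsto_add_at_top[OF tendsto_const]
      filterlim_tendsto_pos_mult_at_top[OF tendsto_const] filterlim_ident) auto
  show "\<forall>\<^sub>F x in at_top. \<rho> 0 + f 0 * x \<le> \<rho> x"
    using eventually_ge_at_top[of 0] by eventually_elim (rule rho_lower)
qed

lemma rho_at_bot: "(\<rho> \<longlongrightarrow> rp) at_bot"
proof (rule order_tendstoI)
  fix a assume "rp < a"
  show "\<forall>\<^sub>F x in at_bot. \<rho> x < a"
    unfolding rho_less_iff_rstar[OF \<open>rp < a\<close>] by (rule eventually_gt_at_bot)
next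
  fix a assume "a < rp"
  then show "\<forall>\<^sub>F x in at_bot. a < \<rho> x"
    by (intro always_eventually allI less_trans[OF _ rho_gt])
qed

lemma f_at_bot: "(f \<longlongrightarrow> 0) at_bot"
proof -
  have "((\<lambda>x. F (\<rho> x)) \<longlongrightarrow> F rp) at_bot"
    using rp_pos by (intro isCont_tendsto_compose[OF _ rho_at_bot] DERIV_isCont[OF F_deriv]) simp
  then show ?thesis using rp_pos by (simp add: f_def[abs_def] F_factor)
qed

text \<open>Turns decay of \<open>\<rho> x - rp\<close> into decay of \<open>f\<close>: the
  remaining factor (r - rm) / r^2 is at most 1 / rp.\<close>

lemma f_le: "f x \<le> (\<rho> x - rp) / rp"
proof -
  have r: "rp < \<rho> x" by (rule rho_gt)
  have "f x = (\<rho> x - rp) * ((\<rho> x - rm) / (\<rho> x)\<^sup>2)"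
    using r rp_pos by (simp add: f_def F_factor)
  also have "\<dots> \<le> (\<rho> x - rp) * (1 / rp)"
  proof (intro mult_left_mono)
    have "(\<rho> x - rm) * rp \<le> \<rho> x * \<rho> x"
      using r rm_pos rm_less rp_pos by (intro mult_mono) auto
    then show "(\<rho> x - rm) / (\<rho> x)\<^sup>2 \<le> 1 / rp"
      using r rp_pos by (simp add: divide_simps power2_eq_square)
  qed (use r in auto)
  finally show ?thesis by simp
qed

text \<open>For x \<le> 0 the radius stays in (rp, \<open>\<rho> 0\<close>], where \<open>dF\<close>
  and (r - rm) / r^2 have positive lower bounds \<open>k1\<close> and \<open>k2\<close>. The first
  inequality says that \<open>f\<close> grows at exponential rate at least \<open>k\<close> away
  from the horizon, the second says the same of \<open>\<rho> x - rp\<close>.\<close>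

lemma redshift:
  obtains k where "k > 0" "\<And>x. x \<le> 0 \<Longrightarrow> k * f x \<le> f' x" "\<And>x. x \<le> 0 \<Longrightarrow> k * (\<rho> x - rp) \<le> f x"
proof -
  define k1 where "k1 = 2 * (M * rp - e\<^sup>2) / \<rho> 0 ^ 3"
  define k2 where "k2 = (rp - rm) / (\<rho> 0)\<^sup>2"
  define k where "k = min k1 k2"
  have "k > 0" using e2_less_Mrp rm_less rho_pos[of 0] by (auto simp: k_def k1_def k2_def)
  moreover have "k * f x \<le> f' x" if "x \<le> 0" for x
  proof -
    have r: "rp < \<rho> x" "\<rho> x \<le> \<rho> 0" using that rho_gt rho_le_iff by auto
    have "M * rp \<le> M * \<rho> x" using r M_pos by simp
    then have "k1 \<le> dF (\<rho> x)"
      unfolding k1_def using r rp_pos e2_less_Mrp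
      by (subst dF_eq) (auto intro!: frac_le power_mono)
    then have "k \<le> dF (\<rho> x)" by (simp add: k_def)
    then show ?thesis using f_pos[of x] by (simp add: f'_def mult.commute)
  qed
  moreover have "k * (\<rho> x - rp) \<le> f x" if "x \<le> 0" for x
  proof -
    have r: "rp < \<rho> x" "\<rho> x \<le> \<rho> 0" using that rho_gt rho_le_iff by auto
    have "k2 \<le> (\<rho> x - rm) / (\<rho> x)\<^sup>2"
      unfolding k2_def using r rp_pos rm_less by (auto intro!: frac_le power_mono)
    then have "k * (\<rho> x - rp) \<le> (\<rho> x - rm) / (\<rho> x)\<^sup>2 * (\<rho> x - rp)"
      using r by (intro mult_right_mono) (auto simp: k_def)
    also have "\<dots> = f x" using r rp_pos by (simp add: f_def F_factor)
    finally show ?thesis .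
  qed
  ultimately show ?thesis using that by blast
qed

text \<open>The origin of the factor 2M in \<open>frakL\<close>: the expression is a polynomial in 1
  / r, which tends to 0, and 2M is its constant term.\<close>

lemma V_rho_cube: "((\<lambda>x. V x * \<rho> x ^ 3) \<longlongrightarrow> 2 * M) at_top"
proof -
  have inv: "((\<lambda>x. 1 / \<rho> x) \<longlongrightarrow> 0) at_top"
    using tendsto_inverse_0_at_top[OF rho_at_top] by (simp add: inverse_eq_divide)
  have "((\<lambda>x. (1 - 2 * M * (1 / \<rho> x) + e\<^sup>2 * (1 / \<rho> x)\<^sup>2) * (2 * M - 2 * e\<^sup>2 * (1 / \<rho> x))) \<longlongrightarrow>
     (1 - 2 * M * 0 + e\<^sup>2 * 0\<^sup>2) * (2 * M - 2 * e\<^sup>2 * 0)) at_top"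
    by (intro tendsto_intros inv)
  moreover have "(1 - 2 * M * (1 / \<rho> x) + e\<^sup>2 * (1 / \<rho> x)\<^sup>2) * (2 * M - 2 * e\<^sup>2 * (1 / \<rho> x)) = V x * \<rho> x ^ 3" for x
    using rho_pos[of x] by (simp add: V_def f'_def f_def F_def dF_def field_simps power2_eq_square power3_eq_cube)
  ultimately show ?thesis by simp
qed

section \<open>Chain rules in the null coordinates\<close>

lemma uminus_shift: "((\<lambda>u. v - u) has_real_derivative - 1) (at u within S)"
  and shift: "((\<lambda>v. v - u) has_real_derivative 1) (at v within S)" for u v :: real
  by (auto intro!: derivative_eq_intros)

lemma rho_u: "((\<lambda>u. \<rho> (v - u)) has_real_derivative - f (v - u)) (at u within S)"
  using DERIV_chain'[OF uminus_shift rho_deriv] by simp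
lemma rho_v: "((\<lambda>v. \<rho> (v - u)) has_real_derivative f (v - u)) (at v within S)"
  using DERIV_chain'[OF shift rho_deriv] by simp
lemma f_u: "((\<lambda>u. f (v - u)) has_real_derivative - f' (v - u)) (at u within S)"
  using DERIV_chain'[OF uminus_shift f_deriv] by simp
lemma f_v: "((\<lambda>v. f (v - u)) has_real_derivative f' (v - u)) (at v within S)"
  using DERIV_chain'[OF shift f_deriv] by simp

text \<open>The antiderivative used for every bound of the form C f / r^3 on the v-derivative of
  r\<phi>, the form in which the data bound arrives.\<close>

lemma uminus_inverse_rho_sq_v:
  "((\<lambda>s. - (C / (2 * (\<rho> (s - u))\<^sup>2))) has_real_derivative C * (f (s - u) / \<rho> (s - u) ^ 3)) (at s within S)"
proof -
  have outer: "((\<lambda>y. - (C / (2 * y\<^sup>2))) has_real_derivative C / y ^ 3) (at y)" if "0 < y" for y :: real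
    using that by (auto intro!: derivative_eq_intros simp: field_simps power2_eq_square power3_eq_cube)
  from DERIV_chain'[OF rho_v outer[OF rho_pos]] show ?thesis by (simp add: mult.commute)
qed

end

subsection \<open>Null derivatives and the traces on the horizon\<close>

locale horizon_wave = reissner_nordstrom +
  fixes U0 D :: real and \<phi> :: "real \<times> real \<Rightarrow> real"
    and G :: "real \<times> real \<Rightarrow> (real \<times> real) \<Rightarrow>\<^sub>L real"
  assumes U0_pos: "0 < U0"
    and phi_deriv: "\<And>q. q \<in> region M e U0 \<Longrightarrow> (\<phi> has_derivative blinfun_apply (G q)) (at q within region M e U0)"
    and G_cont: "continuous_on (region M e U0) G"
    and wave: "null_wave {- U0..} (r_ext M e) (phi_ext M e \<phi>)"
    and data: "data_bounds M e U0 \<phi> D"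
    and limit: "limit_condition M e U0 \<phi>"
begin

definition p :: "real \<Rightarrow> real \<Rightarrow> real \<times> real" where "p u v = (v, \<rho> (v - u))"
definition \<phi>u :: "real \<Rightarrow> real \<Rightarrow> real" where "\<phi>u u v = blinfun_apply (G (p u v)) (0, - f (v - u))"
definition \<phi>v :: "real \<Rightarrow> real \<Rightarrow> real" where "\<phi>v u v = blinfun_apply (G (p u v)) (1, f (v - u))"
definition \<psi> :: "real \<Rightarrow> real \<Rightarrow> real" where "\<psi> u v = \<rho> (v - u) * \<phi> (p u v)"
text \<open>\<open>a\<close> and \<open>b\<close> are the u- and v-derivatives of
  \<open>\<psi>\<close>, written through the total derivative \<open>G\<close> in the coordinates
  (v, r), in which \<open>G\<close> is continuous up to the horizon.\<close>

definition a :: "real \<Rightarrow> real \<Rightarrow> real" where "a u v = \<rho> (v - u) * \<phi>u u v - f (v - u) * \<phi> (p u v)"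
definition b :: "real \<Rightarrow> real \<Rightarrow> real" where "b u v = \<rho> (v - u) * \<phi>v u v + f (v - u) * \<phi> (p u v)"
definition \<phi>H :: "real \<Rightarrow> real" where "\<phi>H v = \<phi> (v, rp)"
definition \<phi>H' :: "real \<Rightarrow> real" where "\<phi>H' v = blinfun_apply (G (v, rp)) (1, 0)"

section \<open>Null derivatives and the wave equation for r\<phi>\<close>

lemma r_ext_eq: "r_ext M e u v = \<rho> (v - u)"
  by (simp add: r_ext_def \<rho>_def)

lemma phi_ext_eq: "phi_ext M e \<phi> u v = \<phi> (p u v)"
  by (simp add: phi_ext_def r_ext_eq p_def)

lemma rphi_ext_eq: "rphi_ext M e \<phi> u v = \<psi> u v"
  by (simp add: rphi_ext_def phi_ext_eq r_ext_eq \<psi>_def)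

lemma p_region: "- U0 \<le> u \<Longrightarrow> 1 \<le> v \<Longrightarrow> p u v \<in> region M e U0"
  using rho_gt by (auto simp: p_def region_def rstar_rho)

lemma horizon_region: "1 \<le> v \<Longrightarrow> (v, rp) \<in> region M e U0"
  by (auto simp: region_def)

lemma phi_p_deriv_u:
  assumes "- U0 \<le> u" "1 \<le> v"
  shows "((\<lambda>u. \<phi> (p u v)) has_real_derivative \<phi>u u v) (at u within {- U0..})"
proof -
  have "((\<lambda>u. p u v) has_derivative (\<lambda>h. (0, - f (v - u) * h))) (at u within {- U0..})"
    unfolding p_def
    by (intro has_derivative_Pair has_derivative_const has_field_derivative_imp_has_derivative[OF rho_u])
  then have "((\<lambda>u. \<phi> (p u v)) has_derivative (\<lambda>h. blinfun_apply (G (p u v)) (0, - f (v - u) * h))) (at u within {- U0..})"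
    by (intro has_derivative_in_compose2[OF phi_deriv]) (use assms p_region in auto)
  moreover have "blinfun_apply (G (p u v)) (0, - f (v - u) * h) = \<phi>u u v * h" for h
    using blinfun.scaleR_right[of "G (p u v)" h "(0, - f (v - u))"] by (simp add: \<phi>u_def mult.commute)
  ultimately show ?thesis by (simp add: has_field_derivative_def)
qed

lemma phi_p_deriv_v:
  assumes "- U0 \<le> u" "1 \<le> v"
  shows "((\<lambda>v. \<phi> (p u v)) has_real_derivative \<phi>v u v) (at v within {1..})"
proof -
  have "((\<lambda>v. p u v) has_derivative (\<lambda>h. (h, f (v - u) * h))) (at v within {1..})"
    unfolding p_def
    by (intro has_derivative_Pair has_derivative_ident has_field_derivative_imp_has_derivative[OF rho_v])
  then have "((\<lambda>v. \<phi> (p u v)) has_derivative (\<lambda>h. blinfun_apply (G (p u v)) (h, f (v - u) * h))) (at v within {1..})"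
    by (intro has_derivative_in_compose2[OF phi_deriv]) (use assms p_region in auto)
  moreover have "blinfun_apply (G (p u v)) (h, f (v - u) * h) = \<phi>v u v * h" for h
    using blinfun.scaleR_right[of "G (p u v)" h "(1, f (v - u))"] by (simp add: \<phi>v_def mult.commute)
  ultimately show ?thesis by (simp add: has_field_derivative_def)
qed

lemma psi_u: "- U0 \<le> u \<Longrightarrow> 1 \<le> v \<Longrightarrow> ((\<lambda>u. \<psi> u v) has_real_derivative a u v) (at u within {- U0..})"
  unfolding \<psi>_def[abs_def] a_def
  using DERIV_mult[OF rho_u phi_p_deriv_u, of u v v] by (simp add: algebra_simps)

lemma psi_v: "- U0 \<le> u \<Longrightarrow> 1 \<le> v \<Longrightarrow> ((\<lambda>v. \<psi> u v) has_real_derivative b u v) (at v within {1..})"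
  unfolding \<psi>_def[abs_def] b_def
  using DERIV_mult[OF rho_v phi_p_deriv_v, of u v u] by (simp add: algebra_simps)

lemma d_u_eqI: "- U0 \<le> u \<Longrightarrow> ((\<lambda>u. g u v) has_real_derivative g') (at u within {- U0..}) \<Longrightarrow> d_u {- U0..} g u v = g'"
  unfolding d_u_def
  by (intro vector_derivative_within at_within_Ici_neq_bot) (simp_all add: has_real_derivative_iff_has_vector_derivative)

lemma d_v_eqI: "1 \<le> v \<Longrightarrow> ((\<lambda>v. g u v) has_real_derivative g') (at v within {1..}) \<Longrightarrow> d_v g u v = g'"
  unfolding d_v_def
  by (intro vector_derivative_within at_within_Ici_neq_bot) (simp_all add: has_real_derivative_iff_has_vector_derivative)

lemma null_derivs:
  assumes "- U0 \<le> u" "1 \<le> v"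
  shows "d_u {- U0..} (phi_ext M e \<phi>) u v = \<phi>u u v" "d_v (phi_ext M e \<phi>) u v = \<phi>v u v"
    "d_u {- U0..} (r_ext M e) u v = - f (v - u)" "d_v (r_ext M e) u v = f (v - u)"
    "d_u {- U0..} (rphi_ext M e \<phi>) u v = a u v" "d_v (rphi_ext M e \<phi>) u v = b u v"
  using assms
  by (auto intro!: d_u_eqI d_v_eqI simp: phi_ext_eq[abs_def] r_ext_eq[abs_def] rphi_ext_eq[abs_def]
        phi_p_deriv_u phi_p_deriv_v psi_u psi_v rho_u rho_v)

lemma phiv_u:
  assumes "- U0 \<le> u" "1 \<le> v"
  shows "((\<lambda>u. \<phi>v u v) has_real_derivative f (v - u) * (\<phi>v u v - \<phi>u u v) / \<rho> (v - u)) (at u within {- U0..})"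
proof -
  obtain w where w: "((\<lambda>u'. d_v (phi_ext M e \<phi>) u' v) has_real_derivative w (u, v)) (at u within {- U0..})"
    "w (u, v) = - (d_v (r_ext M e) u v * d_u {- U0..} (phi_ext M e \<phi>) u v) / r_ext M e u v -
          (d_u {- U0..} (r_ext M e) u v * d_v (phi_ext M e \<phi>) u v) / r_ext M e u v"
    using wave assms unfolding null_wave_def by fastforce
  have "w (u, v) = f (v - u) * (\<phi>v u v - \<phi>u u v) / \<rho> (v - u)"
    using w(2) assms by (simp add: null_derivs r_ext_eq diff_divide_distrib algebra_simps)
  moreover have "((\<lambda>u. \<phi>v u v) has_real_derivative w (u, v)) (at u within {- U0..})"
    by (rule has_field_derivative_transform_within[OF w(1), of 1]) (use assms in \<open>auto simp: null_derivs\<close>)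
  ultimately show ?thesis by simp
qed

text \<open>In the product rule the first-order terms cancel against those of the wave equation.
  What remains comes from differentiating \<open>f\<close>, and f' = V r.\<close>

lemma b_u:
  assumes "- U0 \<le> u" "1 \<le> v"
  shows "((\<lambda>u. b u v) has_real_derivative - (V (v - u) * \<psi> u v)) (at u within {- U0..})"
proof -
  have "((\<lambda>u. b u v) has_real_derivative
      (\<rho> (v - u) * (f (v - u) * (\<phi>v u v - \<phi>u u v) / \<rho> (v - u)) + - f (v - u) * \<phi>v u v)
      + (f (v - u) * \<phi>u u v + - f' (v - u) * \<phi> (p u v))) (at u within {- U0..})"
    unfolding b_def[abs_def]
    using DERIV_add[OF DERIV_mult[OF rho_u phiv_u[OF assms]] DERIV_mult[OF f_u phi_p_deriv_u[OF assms]], of v v]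
    by (simp add: algebra_simps)
  moreover have "(\<rho> (v - u) * (f (v - u) * (\<phi>v u v - \<phi>u u v) / \<rho> (v - u)) + - f (v - u) * \<phi>v u v)
      + (f (v - u) * \<phi>u u v + - f' (v - u) * \<phi> (p u v)) = - (V (v - u) * \<psi> u v)"
  proof -
    have "\<rho> (v - u) * (f (v - u) * (\<phi>v u v - \<phi>u u v) / \<rho> (v - u)) = f (v - u) * (\<phi>v u v - \<phi>u u v)"
      using rho_pos[of "v - u"] by simp
    moreover have "V (v - u) * \<psi> u v = f' (v - u) * \<phi> (p u v)"
      using V_rho[of "v - u"] by (simp add: \<psi>_def flip: mult.assoc)
    ultimately show ?thesis by (simp add: algebra_simps)
  qed
  ultimately show ?thesis by simp
qed

lemma p_cont: "continuous_on S (\<lambda>(u, v). p u v)"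
  unfolding p_def split_def
  by (intro continuous_intros continuous_on_compose2[OF continuous_on_rho[of UNIV]]) auto

lemma phi_cont: "continuous_on (region M e U0) \<phi>"
  using phi_deriv by (meson continuous_on_eq_continuous_within has_derivative_continuous)

lemma p_maps: "(\<lambda>(u, v). p u v) ` ({- U0..} \<times> {1..}) \<subseteq> region M e U0"
  using p_region by auto

lemma psi_cont: "continuous_on ({- U0..} \<times> {1..}) (\<lambda>(u, v). \<psi> u v)"
proof -
  have "continuous_on ({- U0..} \<times> {1..}) (\<lambda>x. \<rho> (snd x - fst x) * \<phi> ((\<lambda>(u, v). p u v) x))"
    by (intro continuous_intros continuous_on_compose2[OF continuous_on_rho[of UNIV]]
          continuous_on_compose2[OF phi_cont p_cont p_maps]) auto
  then show ?thesis by (simp add: \<psi>_def split_def)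
qed

lemma b_cont: "continuous_on ({- U0..} \<times> {1..}) (\<lambda>(u, v). b u v)"
proof -
  have "continuous_on ({- U0..} \<times> {1..}) (\<lambda>x. \<rho> (snd x - fst x) * blinfun_apply (G ((\<lambda>(u, v). p u v) x)) (1, f (snd x - fst x))
      + f (snd x - fst x) * \<phi> ((\<lambda>(u, v). p u v) x))"
    by (intro continuous_intros continuous_on_compose2[OF continuous_on_rho[of UNIV]]
          continuous_on_compose2[OF continuous_on_f[of UNIV]]
          continuous_on_compose2[OF G_cont p_cont p_maps]
          continuous_on_compose2[OF phi_cont p_cont p_maps]) auto
  then show ?thesis by (simp add: b_def \<phi>v_def split_def)
qed

lemma Vpsi_cont: "continuous_on ({- U0..} \<times> {1..}) (\<lambda>(u, v). V (v - u) * \<psi> u v)"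
proof -
  have "continuous_on ({- U0..} \<times> {1..}) (\<lambda>x. V (snd x - fst x) * (\<lambda>(u, v). \<psi> u v) x)"
    by (intro continuous_intros continuous_on_compose2[OF continuous_on_V[of UNIV]] psi_cont) auto
  then show ?thesis by (simp add: split_def)
qed

lemma cont_section_v:
  assumes "continuous_on ({- U0..} \<times> {1..}) (\<lambda>(u, v). g u v)" "- U0 \<le> u" "S \<subseteq> {1..}"
  shows "continuous_on S (g u)"
proof -
  have "continuous_on S (\<lambda>v. (\<lambda>(u, v). g u v) (u, v))"
    by (rule continuous_on_compose2[OF assms(1)]) (use assms in \<open>auto intro!: continuous_intros\<close>)
  then show ?thesis by simp
qed

lemma cont_section_u:
  assumes "continuous_on ({- U0..} \<times> {1..}) (\<lambda>(u, v). g u v)" "1 \<le> v" "S \<subseteq> {- U0..}"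
  shows "continuous_on S (\<lambda>u. g u v)"
proof -
  have "continuous_on S (\<lambda>u. (\<lambda>(u, v). g u v) (u, v))"
    by (rule continuous_on_compose2[OF assms(1)]) (use assms in \<open>auto intro!: continuous_intros\<close>)
  then show ?thesis by simp
qed

text \<open>The equation only controls \<open>\<partial>\<^sub>u \<partial>\<^sub>v\<close>; differentiating \<open>\<psi> u v = \<psi> u 1 + \<integral> b u\<close> under the
  integral sign exchanges the derivatives.\<close>

lemma a_integral:
  assumes u: "- U0 \<le> u" and v: "1 \<le> v"
  shows "a u v = a u 1 + integral {1..v} (\<lambda>s. - (V (s - u) * \<psi> u s))"
proof -
  let ?I = "\<lambda>u. integral (cbox 1 v) (b u)"
  have I: "?I u' = \<psi> u' v - \<psi> u' 1" if "- U0 \<le> u'" for u'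
  proof -
    have "(\<psi> u' has_vector_derivative b u' x) (at x within {1..v})" if "x \<in> {1..v}" for x
      using has_field_derivative_subset[OF psi_v[OF \<open>- U0 \<le> u'\<close>], of x "{1..v}"] that
      by (auto simp: has_real_derivative_iff_has_vector_derivative)
    then have "(b u' has_integral (\<psi> u' v - \<psi> u' 1)) {1..v}"
      by (intro fundamental_theorem_of_calculus[OF v])
    then show ?thesis by (simp add: integral_unique)
  qed
  have "(?I has_field_derivative integral (cbox 1 v) (\<lambda>s. - (V (s - u) * \<psi> u s))) (at u within {- U0..})"
  proof (rule leibniz_rule_field_derivative)
    show "((\<lambda>x. b x t) has_real_derivative - (V (t - x) * \<psi> x t)) (at x within {- U0..})"
      if "x \<in> {- U0..}" "t \<in> cbox 1 v" for x t using that b_u by auto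
    show "b x integrable_on cbox 1 v" if "x \<in> {- U0..}" for x
      using that by (intro integrable_continuous cont_section_v[OF b_cont]) auto
    have "continuous_on ({- U0..} \<times> {1..v}) (\<lambda>x. - (\<lambda>(u, v). V (v - u) * \<psi> u v) x)"
      by (rule continuous_on_minus[OF continuous_on_subset[OF Vpsi_cont]]) auto
    then show "continuous_on ({- U0..} \<times> cbox 1 v) (\<lambda>(x, t). - (V (t - x) * \<psi> x t))"
      by (simp add: split_def)
  qed (use u in auto)
  moreover have "(?I has_field_derivative a u v - a u 1) (at u within {- U0..})"
    by (rule has_field_derivative_transform_within[OF DERIV_diff[OF psi_u[OF u v] psi_u[OF u order_refl]], of 1])
       (use u in \<open>simp_all add: I[simplified]\<close>)
  ultimately have "integral (cbox 1 v) (\<lambda>s. - (V (s - u) * \<psi> u s)) = a u v - a u 1"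
    unfolding has_real_derivative_iff_has_vector_derivative
    by (rule vector_derivative_unique_within[OF at_within_Ici_neq_bot[OF u]])
  then show ?thesis by simp
qed

text \<open>Differentiating \<open>a_integral\<close> gives the mixed derivative in the other order,
  so the equation can also be integrated in \<open>v\<close>, starting from the data on v =
  1.\<close>

lemma a_v:
  assumes u: "- U0 \<le> u" and v: "v \<in> {1..y}"
  shows "((\<lambda>v. a u v) has_real_derivative - (V (v - u) * \<psi> u v)) (at v within {1..y})"
proof -
  have c: "continuous_on {1..y} (\<lambda>s. - (V (s - u) * \<psi> u s))"
    by (intro continuous_intros cont_section_v[OF Vpsi_cont u]) auto
  have "((\<lambda>x. a u 1 + integral {1..x} (\<lambda>s. - (V (s - u) * \<psi> u s))) has_real_derivative 0 + - (V (v - u) * \<psi> u v)) (at v within {1..y})"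
    by (intro DERIV_add DERIV_const integral_has_real_derivative[OF c v])
  then have "((\<lambda>x. a u 1 + integral {1..x} (\<lambda>s. - (V (s - u) * \<psi> u s))) has_real_derivative - (V (v - u) * \<psi> u v)) (at v within {1..y})"
    by simp
  then show ?thesis
  proof (rule has_field_derivative_transform_within[of _ _ _ _ 1])
    show "a u 1 + integral {1..x} (\<lambda>s. - (V (s - u) * \<psi> u s)) = a u x" if "x \<in> {1..y}" for x
      using that by (intro a_integral[OF u, symmetric]) auto
  qed (use v in auto)
qed

section \<open>Limits and traces on the event horizon\<close>

lemma horizon_tendsto:
  assumes v: "1 \<le> v"
  shows "((\<lambda>u. p u v) \<longlongrightarrow> (v, rp)) at_top" "\<forall>\<^sub>F u in at_top. p u v \<in> region M e U0"
    "((\<lambda>u. f (v - u)) \<longlongrightarrow> 0) at_top" "((\<lambda>u. \<rho> (v - u)) \<longlongrightarrow> rp) at_top"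
proof -
  show r: "((\<lambda>u. \<rho> (v - u)) \<longlongrightarrow> rp) at_top" by (rule filterlim_compose[OF rho_at_bot reflect_at_bot])
  show "((\<lambda>u. f (v - u)) \<longlongrightarrow> 0) at_top" by (rule filterlim_compose[OF f_at_bot reflect_at_bot])
  show "((\<lambda>u. p u v) \<longlongrightarrow> (v, rp)) at_top" unfolding p_def by (intro tendsto_intros r)
  show "\<forall>\<^sub>F u in at_top. p u v \<in> region M e U0"
    using eventually_ge_at_top[of "- U0"] by eventually_elim (rule p_region[OF _ v])
qed

lemma psi_horizon: "1 \<le> v \<Longrightarrow> ((\<lambda>u. \<psi> u v) \<longlongrightarrow> rp * \<phi>H v) at_top"
  unfolding \<psi>_def \<phi>H_def
  by (intro tendsto_mult horizon_tendsto continuous_on_tendsto_compose[OF phi_cont] horizon_region)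

text \<open>In the coordinates (v, r) the null derivative has direction (1, f), and f tends to 0 at
  the horizon; continuity of \<open>G\<close> identifies the limit with the derivative tangential to
  the horizon.\<close>

lemma d_v_horizon_eq: "1 \<le> v \<Longrightarrow> d_v_horizon M e \<phi> v = \<phi>H' v"
proof -
  assume v: "1 \<le> v"
  have "((\<lambda>u. \<phi>v u v) \<longlongrightarrow> \<phi>H' v) at_top"
    unfolding \<phi>v_def \<phi>H'_def
    by (intro blinfun.tendsto tendsto_Pair tendsto_const horizon_tendsto v continuous_on_tendsto_compose[OF G_cont] horizon_region)
  then have "((\<lambda>u. d_v (phi_ext M e \<phi>) u v) \<longlongrightarrow> \<phi>H' v) at_top"
    by (rule Lim_transform_eventually)
       (use eventually_ge_at_top[of "- U0"] in eventually_elim, simp add: null_derivs v)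
  then show ?thesis unfolding d_v_horizon_def by (intro tendsto_Lim) auto
qed

lemma phiH_deriv: "1 \<le> v \<Longrightarrow> (\<phi>H has_real_derivative \<phi>H' v) (at v within {1..})"
proof -
  assume v: "1 \<le> v"
  have "((\<lambda>v. (v, rp)) has_derivative (\<lambda>h. (h, 0))) (at v within {1..})"
    by (intro has_derivative_Pair has_derivative_ident has_derivative_const)
  then have "((\<lambda>v. \<phi> (v, rp)) has_derivative (\<lambda>h. blinfun_apply (G (v, rp)) (h, 0))) (at v within {1..})"
    by (intro has_derivative_in_compose2[OF phi_deriv]) (use v horizon_region in auto)
  moreover have "blinfun_apply (G (v, rp)) (h, 0) = \<phi>H' v * h" for h
    using blinfun.scaleR_right[of "G (v, rp)" h "(1, 0)"] by (simp add: \<phi>H'_def mult.commute)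
  ultimately show ?thesis by (simp add: has_field_derivative_def \<phi>H_def[abs_def])
qed

lemma phiH'_cont: "continuous_on {1..} \<phi>H'"
  unfolding \<phi>H'_def
  by (intro continuous_intros continuous_on_compose2[OF G_cont]) (auto intro: horizon_region)

text \<open>The strip is unbounded in u, but in the coordinates (v, r) it becomes compact once its
  piece of the horizon is added. The bound makes the supremum in \<open>psi0_decay\<close>
  finite.\<close>

lemma phi_bounded:
  obtains B where "\<And>u v. - U0 \<le> u \<Longrightarrow> 1 \<le> v \<Longrightarrow> v \<le> v1 \<Longrightarrow> \<bar>\<phi> (p u v)\<bar> \<le> B"
proof -
  define K where "K = ({1..v1} \<times> {rp..\<rho> (v1 + U0)}) \<inter> {q. snd q \<le> \<rho> (fst q + U0)}"
  have "compact K"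
    unfolding K_def
    by (intro compact_Int_closed compact_Times compact_Icc closed_Collect_le continuous_intros
          continuous_on_compose2[OF continuous_on_rho[of UNIV]]) auto
  moreover have "K \<subseteq> region M e U0"
  proof
    fix q assume "q \<in> K"
    then have q: "1 \<le> fst q" "rp \<le> snd q" "snd q \<le> \<rho> (fst q + U0)" by (auto simp: K_def)
    have "rstar M e (snd q) \<le> fst q + U0" if "rp < snd q"
      using rho_less_iff_rstar[OF that, of "fst q + U0"] q by linarith
    then show "q \<in> region M e U0" using q by (cases q) (auto simp: region_def)
  qed
  ultimately have "compact (\<phi> ` K)"
    by (intro compact_continuous_image continuous_on_subset[OF phi_cont])
  then obtain B where B: "\<And>q. q \<in> K \<Longrightarrow> \<bar>\<phi> q\<bar> \<le> B"
    using compact_imp_bounded bounded_iff by (metis imageI real_norm_def)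
  have "p u v \<in> K" if "- U0 \<le> u" "1 \<le> v" "v \<le> v1" for u v
    using that rho_gt[of "v - u"] by (auto simp: K_def p_def rho_le_iff)
  with B that show ?thesis by blast
qed

section \<open>Initial data and convergence along the horizon\<close>

lemma data_u:
  assumes "- U0 \<le> u"
  shows "\<bar>a u 1\<bar> \<le> D * f (1 - u)"
proof -
  have "\<bar>a u 1 / - f (1 - u)\<bar> \<le> D"
    using data assms unfolding data_bounds_def by (metis null_derivs(3,5) order_refl)
  then show ?thesis using f_pos[of "1 - u"] by (simp add: divide_simps)
qed

lemma data_v:
  assumes "1 \<le> v"
  shows "\<bar>b (- U0) v\<bar> \<le> D * (f (v + U0) / \<rho> (v + U0) ^ 3)"
proof -
  have "(r_ext M e (- U0) v)^3 * \<bar>d_v (rphi_ext M e \<phi>) (- U0) v / d_v (r_ext M e) (- U0) v\<bar> \<le> D"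
    using data assms unfolding data_bounds_def by blast
  then show ?thesis using f_pos[of "v + U0"] rho_pos[of "v + U0"] assms
    by (simp add: null_derivs r_ext_eq divide_simps mult.commute)
qed

text \<open>AM-GM with the weight \<open>x powr (- \<alpha>)\<close>, \<open>7 + \<epsilon> = 2 * \<alpha> + 1\<close>, turns the weighted \<open>L\<^sup>2\<close> bound into
  an \<open>L\<^sup>1\<close> bound on \<open>[x, \<infinity>)\<close> of size \<open>x powr (- \<alpha>)\<close>.\<close>

lemma horizon_decay_of_finite_integral:
  assumes \<alpha>: "0 < \<alpha>"
    and fin: "(\<integral>\<^sup>+v\<in>{1..}. ennreal (v powr (2 * \<alpha> + 1) * (d_v_horizon M e \<phi> v)\<^sup>2) \<partial>lborel) \<noteq> \<infinity>"
  obtains \<phi>\<^sub>0 C0 where "\<And>v. 1 \<le> v \<Longrightarrow> \<bar>\<phi>H v - \<phi>\<^sub>0\<bar> \<le> C0 * v powr - \<alpha>"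
proof -
  define q where "q v = v powr (2 * \<alpha> + 1) * (\<phi>H' v)\<^sup>2" for v
  define I where "I = (\<integral>\<^sup>+v\<in>{1..}. ennreal (v powr (2 * \<alpha> + 1) * (d_v_horizon M e \<phi> v)\<^sup>2) \<partial>lborel)"
  define J where "J = enn2real I"
  have I: "I = (\<integral>\<^sup>+v. ennreal (q v) * indicator {1..} v \<partial>lborel)"
    unfolding I_def by (intro nn_integral_cong) (auto simp: q_def d_v_horizon_eq split: split_indicator)
  have q0: "0 \<le> q v" for v by (simp add: q_def)
  have qc: "continuous_on {1..y} q" for y
    unfolding q_def
    by (intro continuous_intros continuous_on_subset[OF phiH'_cont]) auto
  define Q where "Q y = integral {1..y} q" for y
  have QJ: "Q y \<le> J" for y
  proof -
    have si: "set_integrable lborel {1..y} q" by (rule borel_integrable_atLeastAtMost'[OF qc])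
    have "ennreal (Q y) = ennreal (LINT v:{1..y}|lborel. q v)"
      using set_borel_integral_eq_integral(2)[OF si] by (simp add: Q_def)
    also have "\<dots> = (\<integral>\<^sup>+v. ennreal (indicator {1..y} v *\<^sub>R q v) \<partial>lborel)"
      using si q0 unfolding set_integrable_def set_lebesgue_integral_def
      by (intro nn_integral_eq_integral[symmetric]) auto
    also have "\<dots> \<le> I" unfolding I by (intro nn_integral_mono) (auto split: split_indicator)
    finally have "ennreal (Q y) \<le> I" .
    moreover have "I = ennreal J" unfolding J_def using fin by (simp add: I_def less_top)
    ultimately have "ennreal (Q y) \<le> ennreal J" by simp
    moreover have "0 \<le> J" by (simp add: J_def)
    ultimately show ?thesis by (simp add: ennreal_le_iff)
  qed
  have Q0: "0 \<le> Q y" for y unfolding Q_def using q0 by (intro integral_nonneg integrable_continuous_interval qc) auto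
  define C0 where "C0 = (J + 1 / (2 * \<alpha>)) / 2"
  have bd: "\<bar>\<phi>H y - \<phi>H x\<bar> \<le> C0 * x powr - \<alpha>" if xy: "1 \<le> x" "x \<le> y" for x y
  proof -
    \<comment> \<open>The weight is frozen at the left endpoint, so that \<open>l * J\<close> and
      the tail of s powr (- 2\<alpha> - 1) / l both have the size of x powr (- \<alpha>).\<close>
    define l where "l = x powr - \<alpha>"
    have l: "0 < l" using xy by (simp add: l_def)
    define h where "h s = (l * Q s - s powr (- 2 * \<alpha>) / (2 * \<alpha>) / l) / 2" for s
    have "\<bar>\<phi>H y - \<phi>H x\<bar> \<le> h y - h x"
    proof (rule abs_diff_le_of_deriv[OF xy(2)])
      show "(\<phi>H has_real_derivative \<phi>H' s) (at s within {x..y})" if "s \<in> {x..y}" for s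
        using that xy by (intro has_field_derivative_subset[OF phiH_deriv]) auto
      show "(h has_real_derivative (l * q s + s powr (- 2 * \<alpha> - 1) / l) / 2) (at s within {x..y})"
        if "s \<in> {x..y}" for s
      proof -
        have "(Q has_real_derivative q s) (at s within {1..y})"
          unfolding Q_def[abs_def] using that xy by (intro integral_has_real_derivative qc) auto
        then have 1: "(Q has_real_derivative q s) (at s within {x..y})"
          using xy by (rule_tac has_field_derivative_subset) auto
        have 2: "((\<lambda>s. s powr (- 2 * \<alpha>)) has_real_derivative - 2 * \<alpha> * s powr (- 2 * \<alpha> - 1)) (at s within {x..y})"
          using that xy by (intro has_field_derivative_at_within[OF has_real_derivative_powr]) auto
        have "(h has_real_derivative (l * q s - - 2 * \<alpha> * s powr (- 2 * \<alpha> - 1) / (2 * \<alpha>) / l) / 2) (at s within {x..y})"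
          unfolding h_def[abs_def] by (intro DERIV_cdivide DERIV_diff DERIV_cmult 1 2)
        then show ?thesis using \<alpha> by simp
      qed
      show "\<bar>\<phi>H' s\<bar> \<le> (l * q s + s powr (- 2 * \<alpha> - 1) / l) / 2" if s: "x < s" for s
      proof -
        define A where "A = s powr (2 * \<alpha> + 1)"
        have A: "0 < A" using s xy by (simp add: A_def)
        have "2 * \<bar>\<phi>H' s\<bar> \<le> l * (A * \<bar>\<phi>H' s\<bar>\<^sup>2) + 1 / A / l"
        proof -
          have "0 \<le> (l * A * \<bar>\<phi>H' s\<bar> - 1)\<^sup>2 / (l * A)" using l A by simp
          also have "(l * A * \<bar>\<phi>H' s\<bar> - 1)\<^sup>2 = (l * A) * (l * (A * \<bar>\<phi>H' s\<bar>\<^sup>2) - 2 * \<bar>\<phi>H' s\<bar>) + 1"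
            by (simp add: power2_eq_square algebra_simps)
          also have "\<dots> / (l * A) = l * (A * \<bar>\<phi>H' s\<bar>\<^sup>2) - 2 * \<bar>\<phi>H' s\<bar> + 1 / A / l"
            unfolding add_divide_distrib using l A by (simp add: mult.commute)
          finally show ?thesis by simp
        qed
        moreover have "s powr (- 2 * \<alpha> - 1) = 1 / A"
          using powr_minus_divide[of s "2 * \<alpha> + 1"] by (simp add: A_def)
        ultimately show ?thesis by (simp add: q_def A_def)
      qed
    qed
    also have "\<dots> \<le> (l * J + x powr (- 2 * \<alpha>) / (2 * \<alpha>) / l) / 2"
    proof -
      define z where "z s = s powr (- 2 * \<alpha>) / (2 * \<alpha>) / l" for s
      have "h s = (l * Q s - z s) / 2" for s by (simp add: h_def z_def)
      moreover have "l * Q y \<le> l * J" "0 \<le> l * Q x" using QJ Q0 l by auto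
      moreover have "0 \<le> z y" using l \<alpha> by (simp add: z_def)
      ultimately have "h y - h x \<le> (l * J + z x) / 2" by simp
      then show ?thesis by (simp add: z_def)
    qed
    also have "x powr (- 2 * \<alpha>) = l * l" using xy by (simp add: l_def flip: powr_add)
    finally show ?thesis using l by (simp add: C0_def l_def[symmetric] algebra_simps)
  qed
  have "((\<lambda>x. x powr - \<alpha>) \<longlongrightarrow> 0) at_top" using \<alpha> by (intro tendsto_neg_powr filterlim_ident) auto
  then have "((\<lambda>x. C0 * x powr - \<alpha>) \<longlongrightarrow> 0) at_top" by (rule tendsto_mult_right_zero)
  with bd obtain L where "\<And>x. 1 \<le> x \<Longrightarrow> \<bar>L - \<phi>H x\<bar> \<le> C0 * x powr - \<alpha>"
    using convergent_of_cauchy_bound[of 1 \<phi>H "\<lambda>x. C0 * x powr - \<alpha>"] by blast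
  then show ?thesis using that[of L C0] by (simp add: abs_minus_commute)
qed

end

subsection \<open>Decay in the exterior\<close>

text \<open>\<open>k\<close> is the red-shift rate. \<open>c\<close> is the loss allowed in the
  comparison, small enough for \<open>c * (\<rho> 0 - rp)\<close> to use up only half of
  \<open>rp\<close>. The shift \<open>T\<close> keeps t + T positive for t \<ge> - U0 and makes the
  logarithmic rate \<alpha> / (t + T) of the weight at most k and at most c k / (1 + c) for t \<ge>
  1.\<close>

locale horizon_decay = horizon_wave +
  fixes \<alpha> \<phi>\<^sub>0 C0 k c T :: real
  assumes alpha: "3 < \<alpha>"
    and horizon_decay: "\<And>v. 1 \<le> v \<Longrightarrow> \<bar>\<phi>H v - \<phi>\<^sub>0\<bar> \<le> C0 * v powr - \<alpha>"
    and k_pos: "0 < k"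
    and k_f: "\<And>x. x \<le> 0 \<Longrightarrow> k * f x \<le> f' x"
    and k_rho: "\<And>x. x \<le> 0 \<Longrightarrow> k * (\<rho> x - rp) \<le> f x"
    and c_pos: "0 < c"
    and c_le: "c * (\<rho> 0 - rp) \<le> rp / 2"
    and T_U0: "1 + U0 \<le> T"
    and T_c: "(1 + c) * \<alpha> \<le> c * k * (1 + T)"
    and T_k: "\<alpha> \<le> k * (1 + T)"
begin

definition w :: "real \<Rightarrow> real" where "w t = (t + T) powr - \<alpha>"
text \<open>Constants solve the wave equation, so subtracting \<open>\<phi>\<^sub>0\<close> from
  \<phi> leaves a solution, whose trace on the horizon tends to 0. The sign in
  \<open>a\<^sub>0\<close> comes from the u-derivative - f of the radius.\<close>

definition \<psi>\<^sub>0 :: "real \<Rightarrow> real \<Rightarrow> real" where "\<psi>\<^sub>0 u v = \<psi> u v - \<phi>\<^sub>0 * \<rho> (v - u)"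
definition a\<^sub>0 :: "real \<Rightarrow> real \<Rightarrow> real" where "a\<^sub>0 u v = a u v + \<phi>\<^sub>0 * f (v - u)"
definition D1 :: real where "D1 = \<bar>D\<bar> + \<bar>\<phi>\<^sub>0\<bar>"

section \<open>The weight and the subtracted solution\<close>

lemma T_ge: "1 \<le> T" using T_U0 U0_pos by simp
lemma w_pos: "- U0 \<le> t \<Longrightarrow> 0 < w t" using T_U0 by (simp add: w_def)
lemma w_mono: "- U0 \<le> s \<Longrightarrow> s \<le> t \<Longrightarrow> w t \<le> w s"
  using T_U0 alpha by (auto simp: w_def intro!: powr_mono2')

lemma D1_nonneg: "0 \<le> D1" by (simp add: D1_def)

lemma psi0_u: "- U0 \<le> u \<Longrightarrow> 1 \<le> v \<Longrightarrow> ((\<lambda>u. \<psi>\<^sub>0 u v) has_real_derivative a\<^sub>0 u v) (at u within {- U0..})"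
proof -
  assume "- U0 \<le> u" "1 \<le> v"
  then have "((\<lambda>u. \<psi> u v - \<phi>\<^sub>0 * \<rho> (v - u)) has_real_derivative a u v - \<phi>\<^sub>0 * - f (v - u)) (at u within {- U0..})"
    by (intro DERIV_diff DERIV_cmult psi_u rho_u)
  then show ?thesis by (simp add: \<psi>\<^sub>0_def[abs_def] a\<^sub>0_def)
qed

lemma a0_v:
  assumes "- U0 \<le> u" "v \<in> {1..y}"
  shows "((\<lambda>v. a\<^sub>0 u v) has_real_derivative - (V (v - u) * \<psi>\<^sub>0 u v)) (at v within {1..y})"
proof -
  have "((\<lambda>v. a u v + \<phi>\<^sub>0 * f (v - u)) has_real_derivative - (V (v - u) * \<psi> u v) + \<phi>\<^sub>0 * f' (v - u)) (at v within {1..y})"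
    by (intro DERIV_add a_v assms DERIV_cmult f_v)
  moreover have "- (V (v - u) * \<psi> u v) + \<phi>\<^sub>0 * f' (v - u) = - (V (v - u) * \<psi>\<^sub>0 u v)"
    using V_rho[of "v - u"] by (simp add: \<psi>\<^sub>0_def algebra_simps)
  ultimately show ?thesis by (simp add: a\<^sub>0_def[abs_def])
qed

lemma a0_data: "- U0 \<le> u \<Longrightarrow> \<bar>a\<^sub>0 u 1\<bar> \<le> D1 * f (1 - u)"
proof -
  assume "- U0 \<le> u"
  then have "\<bar>a u 1\<bar> \<le> D * f (1 - u)" by (rule data_u)
  also have "\<dots> \<le> \<bar>D\<bar> * f (1 - u)" using f_pos[of "1 - u"] by (intro mult_right_mono) auto
  finally have "\<bar>a u 1\<bar> \<le> \<bar>D\<bar> * f (1 - u)" .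
  moreover have "\<bar>\<phi>\<^sub>0 * f (1 - u)\<bar> = \<bar>\<phi>\<^sub>0\<bar> * f (1 - u)" using f_pos[of "1 - u"] by (simp add: abs_mult)
  ultimately show ?thesis unfolding a\<^sub>0_def D1_def by (simp add: algebra_simps)
qed

lemma psi0_horizon: "1 \<le> v \<Longrightarrow> ((\<lambda>u. \<psi>\<^sub>0 u v) \<longlongrightarrow> rp * (\<phi>H v - \<phi>\<^sub>0)) at_top"
  unfolding \<psi>\<^sub>0_def right_diff_distrib
  using tendsto_diff[OF psi_horizon tendsto_mult[OF tendsto_const[of \<phi>\<^sub>0] horizon_tendsto(4)]]
  by (simp add: mult.commute)

lemma w_deriv: "- U0 \<le> t \<Longrightarrow> (w has_real_derivative - (\<alpha> / (t + T) * w t)) (at t within S)"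
proof -
  assume "- U0 \<le> t"
  then have t: "0 < t + T" using T_U0 by simp
  have "(w has_real_derivative - \<alpha> * (t + T) powr (- \<alpha> - 1)) (at t)"
    unfolding w_def[abs_def] using t by (auto intro!: derivative_eq_intros)
  moreover have "- \<alpha> * (t + T) powr (- \<alpha> - 1) = - (\<alpha> / (t + T) * w t)"
    using t by (simp add: w_def powr_diff)
  ultimately show ?thesis by (simp add: has_field_derivative_at_within)
qed

text \<open>The red-shift \<open>k * f \<le> f'\<close> makes \<open>f\<close> grow so fast along \<open>u = const\<close> near the horizon that the
  slowly varying weight \<open>w\<close> costs only the factor \<open>1 + c\<close>.\<close>

lemma a0_growth_near:
  assumes u': "u \<le> u'" "- U0 \<le> u" and v: "1 \<le> v" "v \<le> u" and N: "0 \<le> N"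
    and bd: "\<And>s. 1 \<le> s \<Longrightarrow> s \<le> v \<Longrightarrow> \<bar>\<psi>\<^sub>0 u' s\<bar> \<le> N * \<rho> (s - u') * w (min u s)"
  shows "\<bar>a\<^sub>0 u' v - a\<^sub>0 u' 1\<bar> \<le> N * w v * ((1 + c) * f (v - u'))"
proof -
  let ?h = "\<lambda>s. N * (1 + c) * (w s * f (s - u'))"
  let ?h' = "\<lambda>s. N * (1 + c) * (- (\<alpha> / (s + T) * w s) * f (s - u') + f' (s - u') * w s)"
  have "\<bar>a\<^sub>0 u' v - a\<^sub>0 u' 1\<bar> \<le> ?h v - ?h 1"
  proof (rule abs_diff_le_of_deriv[OF v(1)])
    show "((\<lambda>v. a\<^sub>0 u' v) has_real_derivative - (V (s - u') * \<psi>\<^sub>0 u' s)) (at s within {1..v})"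
      if "s \<in> {1..v}" for s using that u' by (intro a0_v) auto
    show "(?h has_real_derivative ?h' s) (at s within {1..v})" if "s \<in> {1..v}" for s
      using that U0_pos by (intro DERIV_cmult DERIV_mult w_deriv f_v) auto
    show "\<bar>- (V (s - u') * \<psi>\<^sub>0 u' s)\<bar> \<le> ?h' s" if s: "1 < s" "s < v" for s
    proof -
      have w: "0 < w s" using s U0_pos by (intro w_pos) auto
      have le0: "s - u' \<le> 0" using s v u' by auto
      have f: "0 < f (s - u')" by (rule f_pos)
      \<comment> \<open>By \<open>T_c\<close> and s \<ge> 1. Hence differentiating \<open>w\<close>
        costs at most c f' out of (1 + c) f', and the f' needed to bound the potential term is
        left.\<close>
      have "(1 + c) * (\<alpha> / (s + T)) \<le> c * k"
      proof -
        have "c * k * (1 + T) \<le> c * k * (s + T)" using s c_pos k_pos by (intro mult_left_mono) auto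
        then show ?thesis using T_c s T_ge by (simp add: divide_le_eq)
      qed
      then have "(1 + c) * (\<alpha> / (s + T)) * f (s - u') \<le> c * k * f (s - u')"
        using f by (intro mult_right_mono) auto
      also have "\<dots> \<le> c * f' (s - u')" using mult_left_mono[OF k_f[OF le0], of c] c_pos by (simp add: mult.assoc)
      finally have "f' (s - u') \<le> (1 + c) * (f' (s - u') - \<alpha> / (s + T) * f (s - u'))"
        by (simp add: algebra_simps)
      then have "N * w s * f' (s - u') \<le> N * w s * ((1 + c) * (f' (s - u') - \<alpha> / (s + T) * f (s - u')))"
        using w N by (intro mult_left_mono) auto
      also have "\<dots> = ?h' s" by (simp add: algebra_simps)
      finally have 1: "N * w s * f' (s - u') \<le> ?h' s" .
      have "\<bar>- (V (s - u') * \<psi>\<^sub>0 u' s)\<bar> \<le> V (s - u') * (N * \<rho> (s - u') * w (min u s))"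
        unfolding abs_minus_cancel abs_mult abs_of_nonneg[OF V_nonneg]
        using s by (intro mult_left_mono bd V_nonneg) auto
      also have "\<dots> = N * w s * f' (s - u')"
        using V_rho[of "s - u'"] s v by (simp add: min_def algebra_simps)
      finally show ?thesis using 1 by linarith
    qed
  qed
  moreover have "0 \<le> ?h 1" using N c_pos w_pos[of 1] U0_pos f_pos[of "1 - u'"] by (intro mult_nonneg_nonneg) auto
  ultimately show ?thesis by (simp add: algebra_simps)
qed

text \<open>Beyond s = u the weight is the constant \<open>w u\<close>, and V r = f' makes the bound
  an exact derivative, without the loss \<open>c\<close>.\<close>

lemma a0_growth_far:
  assumes u': "u \<le> u'" "- U0 \<le> u" and v: "1 \<le> v0" "u \<le> v0" "v0 \<le> v" and N: "0 \<le> N"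
    and bd: "\<And>s. v0 \<le> s \<Longrightarrow> s \<le> v \<Longrightarrow> \<bar>\<psi>\<^sub>0 u' s\<bar> \<le> N * \<rho> (s - u') * w (min u s)"
  shows "\<bar>a\<^sub>0 u' v - a\<^sub>0 u' v0\<bar> \<le> N * w u * (f (v - u') - f (v0 - u'))"
proof -
  let ?h = "\<lambda>s. N * w u * f (s - u')"
  have "\<bar>a\<^sub>0 u' v - a\<^sub>0 u' v0\<bar> \<le> ?h v - ?h v0"
  proof (rule abs_diff_le_of_deriv[OF v(3)])
    show "((\<lambda>v. a\<^sub>0 u' v) has_real_derivative - (V (s - u') * \<psi>\<^sub>0 u' s)) (at s within {v0..v})"
      if "s \<in> {v0..v}" for s
      using that u' v by (intro has_field_derivative_subset[OF a0_v[of _ _ v]]) auto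
    show "(?h has_real_derivative N * w u * f' (s - u')) (at s within {v0..v})" for s
      by (intro DERIV_cmult f_v)
    show "\<bar>- (V (s - u') * \<psi>\<^sub>0 u' s)\<bar> \<le> N * w u * f' (s - u')" if s: "v0 < s" "s < v" for s
    proof -
      have "\<bar>- (V (s - u') * \<psi>\<^sub>0 u' s)\<bar> \<le> V (s - u') * (N * \<rho> (s - u') * w (min u s))"
        unfolding abs_minus_cancel abs_mult abs_of_nonneg[OF V_nonneg]
        using s by (intro mult_left_mono bd V_nonneg) auto
      also have "\<dots> = N * w u * f' (s - u')"
        using V_rho[of "s - u'"] s v by (simp add: min_def algebra_simps)
      finally show ?thesis .
    qed
  qed
  then show ?thesis by (simp add: algebra_simps)
qed

text \<open>Joins the two estimates at s = u when that point lies in range. The weight refers to the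
  fixed \<open>u\<close> instead of \<open>u'\<close>, so the result can be integrated over all u'
  \<ge> u.\<close>

lemma a0_growth:
  assumes u': "u \<le> u'" "- U0 \<le> u" and v: "1 \<le> v" and N: "0 \<le> N"
    and bd: "\<And>s. 1 \<le> s \<Longrightarrow> s \<le> v \<Longrightarrow> \<bar>\<psi>\<^sub>0 u' s\<bar> \<le> N * \<rho> (s - u') * w (min u s)"
  shows "\<bar>a\<^sub>0 u' v - a\<^sub>0 u' 1\<bar> \<le> N * w (min u v) * (f (v - u') + c * f (min u v - u'))"
proof (cases "v \<le> u")
  case True
  then show ?thesis using a0_growth_near[OF u' v True N bd] by (simp add: min_def algebra_simps)
next
  case False
  have m: "min u v = u" using False by simp
  have Nw: "0 \<le> N * w u" using N w_pos[OF u'(2)] by simp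
  show ?thesis
  proof (cases "1 \<le> u")
    case True
    have "\<bar>a\<^sub>0 u' u - a\<^sub>0 u' 1\<bar> \<le> N * w u * ((1 + c) * f (u - u'))"
      using True False by (intro a0_growth_near[OF u' True order_refl N] bd) auto
    moreover have "\<bar>a\<^sub>0 u' v - a\<^sub>0 u' u\<bar> \<le> N * w u * (f (v - u') - f (u - u'))"
      using True False by (intro a0_growth_far[OF u' True order_refl _ N] bd) auto
    ultimately show ?thesis unfolding m by (simp add: algebra_simps)
  next
    case False
    have "\<bar>a\<^sub>0 u' v - a\<^sub>0 u' 1\<bar> \<le> N * w u * (f (v - u') - f (1 - u'))"
      using False v by (intro a0_growth_far[OF u' order_refl _ _ N] bd) auto
    also have "\<dots> \<le> N * w u * (f (v - u') + c * f (u - u'))"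
      using Nw f_pos[of "1 - u'"] mult_pos_pos[OF c_pos f_pos[of "u - u'"]] by (intro mult_left_mono) auto
    finally show ?thesis unfolding m .
  qed
qed

text \<open>Integrates the u-derivative along v = const up to the horizon, where the trace is known.
  The \<open>D1\<close> term stems from the data on v = 1, the other from \<open>a0_growth\<close>;
  each \<open>f\<close> integrates to a radius, whose limit \<open>rp\<close> at the horizon is
  subtracted.\<close>

lemma psi0_sideways:
  assumes u: "- U0 \<le> u" and v: "1 \<le> v" and N: "0 \<le> N"
    and bd: "\<And>u' s. u \<le> u' \<Longrightarrow> 1 \<le> s \<Longrightarrow> s \<le> v \<Longrightarrow> \<bar>\<psi>\<^sub>0 u' s\<bar> \<le> N * \<rho> (s - u') * w (min u s)"
  shows "\<bar>rp * (\<phi>H v - \<phi>\<^sub>0) - \<psi>\<^sub>0 u v\<bar> \<le> D1 * (\<rho> (1 - u) - rp)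
    + N * w (min u v) * (\<rho> (v - u) - rp + c * (\<rho> (min u v - u) - rp))"
proof -
  define m where "m = min u v"
  define h where "h x = D1 * \<rho> (1 - x) + N * w m * (\<rho> (v - x) + c * \<rho> (m - x))" for x
  let ?h' = "\<lambda>x. D1 * f (1 - x) + N * w m * (f (v - x) + c * f (m - x))"
  have h: "((\<lambda>x. - h x) has_real_derivative ?h' x) (at x within S)" for x S
  proof -
    have "(h has_real_derivative D1 * - f (1 - x) + N * w m * (- f (v - x) + c * - f (m - x))) (at x within S)"
      unfolding h_def[abs_def] by (intro DERIV_add DERIV_cmult rho_u)
    from DERIV_minus[OF this] show ?thesis by (simp add: algebra_simps)
  qed
  have step: "\<bar>\<psi>\<^sub>0 y v - \<psi>\<^sub>0 u v\<bar> \<le> - h y - (- h u)" if "u \<le> y" for y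
  proof (rule abs_diff_le_of_deriv[OF that])
    show "((\<lambda>u. \<psi>\<^sub>0 u v) has_real_derivative a\<^sub>0 x v) (at x within {u..y})" if "x \<in> {u..y}" for x
      using that u v by (intro has_field_derivative_subset[OF psi0_u]) auto
    show "((\<lambda>x. - h x) has_real_derivative ?h' x) (at x within {u..y})" for x by (rule h)
    show "\<bar>a\<^sub>0 x v\<bar> \<le> ?h' x" if "u < x" "x < y" for x
    proof -
      have "\<bar>a\<^sub>0 x v - a\<^sub>0 x 1\<bar> \<le> N * w m * (f (v - x) + c * f (m - x))"
        unfolding m_def using that u v N by (intro a0_growth bd) auto
      then show ?thesis using a0_data[of x] u that by auto
    qed
  qed
  have shift_bot: "((\<lambda>x. \<rho> (s - x)) \<longlongrightarrow> rp) at_top" for s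
    by (rule filterlim_compose[OF rho_at_bot reflect_at_bot])
  have "((\<lambda>y. - h y - (- h u)) \<longlongrightarrow> - (D1 * rp + N * w m * (rp + c * rp)) - (- h u)) at_top"
    unfolding h_def by (intro tendsto_intros shift_bot)
  then have "\<bar>rp * (\<phi>H v - \<phi>\<^sub>0) - \<psi>\<^sub>0 u v\<bar> \<le> - (D1 * rp + N * w m * (rp + c * rp)) - (- h u)"
  proof (rule tendsto_le[rotated])
    show "((\<lambda>y. \<bar>\<psi>\<^sub>0 y v - \<psi>\<^sub>0 u v\<bar>) \<longlongrightarrow> \<bar>rp * (\<phi>H v - \<phi>\<^sub>0) - \<psi>\<^sub>0 u v\<bar>) at_top"
      by (intro tendsto_intros psi0_horizon v)
    show "\<forall>\<^sub>F y in at_top. \<bar>\<psi>\<^sub>0 y v - \<psi>\<^sub>0 u v\<bar> \<le> - h y - (- h u)"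
      using eventually_ge_at_top[of u] by eventually_elim (rule step)
  qed simp
  then show ?thesis unfolding m_def[symmetric] by (simp add: h_def algebra_simps)
qed

text \<open>For u \<ge> 1, \<open>k_rho\<close> makes the left side decrease at logarithmic rate at
  least \<open>k\<close>, which by \<open>T_k\<close> beats the rate \<alpha> / (u + T) of the
  weight. For u \<le> 1 monotonicity bounds both factors.\<close>

lemma data_decay:
  obtains E where "0 \<le> E" "\<And>u. - U0 \<le> u \<Longrightarrow> \<rho> (1 - u) - rp \<le> E * w u"
proof -
  define E where "E = (\<rho> (1 + U0) - rp) * (1 + T) powr \<alpha>"
  have key: "(\<rho> (1 - u) - rp) * (u + T) powr \<alpha> \<le> E" if u: "- U0 \<le> u" for u
  proof (cases "u \<le> 1")
    case True
    have "\<rho> (1 - u) \<le> \<rho> (1 + U0)" using u by (simp add: rho_le_iff)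
    moreover have "(u + T) powr \<alpha> \<le> (1 + T) powr \<alpha>"
      using True u T_U0 alpha by (intro powr_mono2) auto
    ultimately show ?thesis unfolding E_def
      using rho_gt[of "1 - u"] by (intro mult_mono) auto
  next
    case False
    let ?g = "\<lambda>u. (\<rho> (1 - u) - rp) * (u + T) powr \<alpha>"
    have "?g u \<le> ?g 1"
    proof (rule DERIV_nonpos_imp_nonincreasing[of 1 u])
      fix x assume x: "1 \<le> x" "x \<le> u"
      have xT: "0 < x + T" using x T_ge by simp
      have "((\<lambda>u. \<rho> (1 - u) - rp) has_real_derivative - f (1 - x) - 0) (at x)"
        by (intro DERIV_diff rho_u DERIV_const)
      moreover have "((\<lambda>x. (x + T) powr \<alpha>) has_real_derivative \<alpha> * (x + T) powr (\<alpha> - 1)) (at x)"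
        using xT by (auto intro!: derivative_eq_intros)
      ultimately have "(?g has_real_derivative (- f (1 - x) - 0) * (x + T) powr \<alpha> + \<alpha> * (x + T) powr (\<alpha> - 1) * (\<rho> (1 - x) - rp)) (at x)"
        by (rule DERIV_mult)
      moreover have "(- f (1 - x) - 0) * (x + T) powr \<alpha> + \<alpha> * (x + T) powr (\<alpha> - 1) * (\<rho> (1 - x) - rp) \<le> 0"
      proof -
        have "\<alpha> / (x + T) \<le> k"
        proof -
          have "k * (1 + T) \<le> k * (x + T)" using x k_pos by (intro mult_left_mono) auto
          then show ?thesis using T_k xT by (simp add: divide_le_eq)
        qed
        then have "\<alpha> / (x + T) * (\<rho> (1 - x) - rp) \<le> k * (\<rho> (1 - x) - rp)"
          using rho_gt[of "1 - x"] by (intro mult_right_mono) auto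
        also have "\<dots> \<le> f (1 - x)" using x by (intro k_rho) auto
        finally have "(x + T) powr \<alpha> * (\<alpha> / (x + T) * (\<rho> (1 - x) - rp)) \<le> (x + T) powr \<alpha> * f (1 - x)"
          by (intro mult_left_mono) auto
        moreover have "\<alpha> * (x + T) powr (\<alpha> - 1) * (\<rho> (1 - x) - rp)
            = (x + T) powr \<alpha> * (\<alpha> / (x + T) * (\<rho> (1 - x) - rp))"
          using xT by (simp add: powr_diff)
        ultimately show ?thesis by (simp add: mult.commute)
      qed
      ultimately show "\<exists>y. (?g has_real_derivative y) (at x) \<and> y \<le> 0" by blast
    qed (use False in auto)
    also have "?g 1 \<le> E" unfolding E_def using U0_pos by (intro mult_right_mono) (auto simp: rho_le_iff)
    finally show ?thesis .
  qed
  have "0 \<le> E" using rho_gt[of "1 + U0"] by (simp add: E_def)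
  moreover have "\<rho> (1 - u) - rp \<le> E * w u" if "- U0 \<le> u" for u
    using key[OF that] that T_U0 by (simp add: w_def powr_minus divide_simps)
  ultimately show ?thesis using that by blast
qed

text \<open>A supremum argument on each strip: if the best constant relative to the comparison
  function exceeded 1, \<open>psi0_sideways\<close> would improve it by a fixed amount. The gain is
  the \<open>rp\<close> subtracted there, of which half survives the loss from
  \<open>c\<close>.\<close>

lemma psi0_decay:
  obtains K where "0 < K" "\<And>u v. - U0 \<le> u \<Longrightarrow> 1 \<le> v \<Longrightarrow> \<bar>\<psi>\<^sub>0 u v\<bar> \<le> K * \<rho> (v - u) * w (min u v)"
proof -
  obtain E where E: "0 \<le> E" "\<And>u. - U0 \<le> u \<Longrightarrow> \<rho> (1 - u) - rp \<le> E * w u"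
    using data_decay by blast
  \<comment> \<open>\<open>G0\<close> collects the horizon trace and the data on v = 1 in units of
    the weight. \<open>K\<close> is so large that \<open>G0\<close> is covered by the surviving half
    of \<open>K * rp\<close>.\<close>
  define G0 where "G0 = rp * (\<bar>C0\<bar> * (1 + T) powr \<alpha>) + D1 * E"
  define K where "K = 2 * G0 / rp + 1"
  have G0: "0 \<le> G0" using rp_pos D1_nonneg E by (simp add: G0_def)
  have K: "0 < K" "G0 \<le> K * rp / 2" using G0 rp_pos by (auto simp: K_def field_simps)
  have wm: "0 < w (min u v)" if "- U0 \<le> u" "1 \<le> v" for u v
    using that U0_pos by (intro w_pos) auto
  have hor: "rp * \<bar>\<phi>H v - \<phi>\<^sub>0\<bar> + D1 * (\<rho> (1 - u) - rp) \<le> G0 * w (min u v)"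
    if "- U0 \<le> u" "1 \<le> v" for u v
  proof -
    have "v powr - \<alpha> \<le> (1 + T) powr \<alpha> * w v"
    proof -
      have "v + T \<le> (1 + T) * v" using that T_ge by (simp add: algebra_simps)
      then have "((1 + T) * v) powr - \<alpha> \<le> (v + T) powr - \<alpha>"
        using that T_ge alpha by (intro powr_mono2') auto
      then have "(1 + T) powr \<alpha> * ((1 + T) powr - \<alpha> * v powr - \<alpha>) \<le> (1 + T) powr \<alpha> * w v"
        using that T_ge by (intro mult_left_mono) (auto simp: w_def powr_mult)
      then show ?thesis using T_ge by (simp add: powr_minus field_simps)
    qed
    also have "\<dots> \<le> (1 + T) powr \<alpha> * w (min u v)"
      using that U0_pos by (intro mult_left_mono w_mono) auto
    finally have "\<bar>C0\<bar> * v powr - \<alpha> \<le> \<bar>C0\<bar> * ((1 + T) powr \<alpha> * w (min u v))"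
      by (intro mult_left_mono) auto
    moreover have "\<bar>\<phi>H v - \<phi>\<^sub>0\<bar> \<le> \<bar>C0\<bar> * v powr - \<alpha>"
      using horizon_decay[OF that(2)] mult_right_mono[OF abs_ge_self[of C0], of "v powr - \<alpha>"] by auto
    ultimately have "rp * \<bar>\<phi>H v - \<phi>\<^sub>0\<bar> \<le> rp * (\<bar>C0\<bar> * ((1 + T) powr \<alpha> * w (min u v)))"
      using rp_pos by (intro mult_left_mono) auto
    moreover have "D1 * (\<rho> (1 - u) - rp) \<le> D1 * (E * w (min u v))"
    proof (intro mult_left_mono D1_nonneg order_trans[OF E(2)] E(1))
      show "w u \<le> w (min u v)" using that U0_pos by (intro w_mono) auto
    qed (use that in auto)
    ultimately show ?thesis by (simp add: G0_def algebra_simps)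
  qed
  have "\<bar>\<psi>\<^sub>0 u v\<bar> \<le> K * \<rho> (v - u) * w (min u v)" if u: "- U0 \<le> u" and v: "1 \<le> v" for u v
  proof -
    let ?Q = "{- U0..} \<times> {1..v}"
    define g where "g = (\<lambda>(u, v). \<bar>\<psi>\<^sub>0 u v\<bar> / (K * \<rho> (v - u) * w (min u v)))"
    \<comment> \<open>Finite, because \<phi> is bounded on the strip and the weight is at least
      \<open>w v\<close> there.\<close>
    define N where "N = (SUP q\<in>?Q. g q)"
    have pos: "0 < K * \<rho> (s - x) * w (min x s)" if "- U0 \<le> x" "1 \<le> s" for x s
      using K rho_pos[of "s - x"] wm[OF that] by simp
    obtain B where B: "\<And>x s. - U0 \<le> x \<Longrightarrow> 1 \<le> s \<Longrightarrow> s \<le> v \<Longrightarrow> \<bar>\<phi> (p x s)\<bar> \<le> B"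
      using phi_bounded[of v] by blast
    have bdd: "bdd_above (g ` ?Q)"
    proof (rule bdd_aboveI2)
      fix q assume "q \<in> ?Q"
      then obtain x s where q: "q = (x, s)" "- U0 \<le> x" "1 \<le> s" "s \<le> v" by auto
      have B0: "0 \<le> B + \<bar>\<phi>\<^sub>0\<bar>" using B[OF q(2-4)] by linarith
      have wv: "0 < w v" using v U0_pos by (intro w_pos) auto
      have ww: "w v \<le> w (min x s)" using q U0_pos by (intro w_mono) auto
      have "\<psi>\<^sub>0 x s = \<rho> (s - x) * (\<phi> (p x s) - \<phi>\<^sub>0)" by (simp add: \<psi>\<^sub>0_def \<psi>_def algebra_simps)
      then have "g q = \<bar>\<phi> (p x s) - \<phi>\<^sub>0\<bar> / (K * w (min x s))"
        using rho_pos[of "s - x"] by (simp add: g_def q abs_mult)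
      also have "\<dots> \<le> (B + \<bar>\<phi>\<^sub>0\<bar>) / (K * w v)"
        using B[OF q(2-4)] B0 wv ww K by (intro frac_le mult_left_mono) auto
      finally show "g q \<le> (B + \<bar>\<phi>\<^sub>0\<bar>) / (K * w v)" .
    qed
    have gN: "\<bar>\<psi>\<^sub>0 x s\<bar> \<le> N * (K * \<rho> (s - x) * w (min x s))" if "- U0 \<le> x" "1 \<le> s" "s \<le> v" for x s
    proof -
      have "g (x, s) \<le> N" unfolding N_def using that by (intro cSUP_upper bdd) auto
      then show ?thesis using pos[of x s] that by (simp add: g_def pos_divide_le_eq)
    qed
    have "N \<le> 1"
    proof (rule ccontr)
      assume "\<not> N \<le> 1"
      then have N: "1 < N" by simp
      \<comment> \<open>Turns the gain rp / 2 into a fixed fraction of the radius, which is at most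
        \<open>\<rho> (v + U0)\<close> on the strip.\<close>
      define \<theta> where "\<theta> = rp / (2 * \<rho> (v + U0))"
      have \<theta>: "0 < \<theta>" using rp_pos rho_pos by (simp add: \<theta>_def)
      have "g q \<le> N - (N - 1) * \<theta>" if "q \<in> ?Q" for q
      proof -
        obtain x s where q: "q = (x, s)" "- U0 \<le> x" "1 \<le> s" "s \<le> v" using \<open>q \<in> ?Q\<close> by auto
        define m where "m = min x s"
        have w0: "0 < w m" unfolding m_def by (rule wm[OF q(2,3)])
        have "\<bar>rp * (\<phi>H s - \<phi>\<^sub>0) - \<psi>\<^sub>0 x s\<bar> \<le> D1 * (\<rho> (1 - x) - rp)
          + (N * K) * w m * (\<rho> (s - x) - rp + c * (\<rho> (m - x) - rp))"
          unfolding m_def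
        proof (rule psi0_sideways[OF q(2,3)])
          show "\<bar>\<psi>\<^sub>0 u' t\<bar> \<le> N * K * \<rho> (t - u') * w (min x t)" if t: "x \<le> u'" "1 \<le> t" "t \<le> s" for u' t
          proof -
            have "\<bar>\<psi>\<^sub>0 u' t\<bar> \<le> N * (K * \<rho> (t - u') * w (min u' t))" using t q by (intro gN) auto
            also have "\<dots> \<le> N * (K * \<rho> (t - u') * w (min x t))"
              using N K t q U0_pos rho_pos[of "t - u'"] by (intro mult_left_mono w_mono) auto
            finally show ?thesis by (simp add: mult.assoc)
          qed
        qed (use N K in auto)
        moreover have "rp * \<bar>\<phi>H s - \<phi>\<^sub>0\<bar> = \<bar>rp * (\<phi>H s - \<phi>\<^sub>0)\<bar>" using rp_pos by (simp add: abs_mult)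
        ultimately have "\<bar>\<psi>\<^sub>0 x s\<bar> \<le> G0 * w m + (N * K) * w m * (\<rho> (s - x) - rp + c * (\<rho> (m - x) - rp))"
          using hor[OF q(2,3)] unfolding m_def by linarith
        also have "\<dots> \<le> K * rp / 2 * w m + (N * K) * w m * (\<rho> (s - x) - rp / 2)"
        proof (intro add_mono mult_right_mono mult_left_mono K(2))
          have "c * (\<rho> (m - x) - rp) \<le> c * (\<rho> 0 - rp)"
            using c_pos by (intro mult_left_mono) (auto simp: m_def rho_le_iff)
          then show "\<rho> (s - x) - rp + c * (\<rho> (m - x) - rp) \<le> \<rho> (s - x) - rp / 2" using c_le by linarith
        qed (use w0 N K in auto)
        also have "\<dots> = N * K * w m * \<rho> (s - x) - (N - 1) * (K * w m) * (rp / 2)" by (simp add: algebra_simps)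
        also have "\<dots> \<le> N * K * w m * \<rho> (s - x) - (N - 1) * (K * w m) * (\<theta> * \<rho> (s - x))"
        proof -
          have "\<rho> (s - x) \<le> \<rho> (v + U0)" using q by (simp add: rho_le_iff)
          then have "\<theta> * \<rho> (s - x) \<le> \<theta> * \<rho> (v + U0)" using \<theta> by (intro mult_left_mono) auto
          also have "\<dots> = rp / 2" using rho_pos[of "v + U0"] by (simp add: \<theta>_def)
          finally show ?thesis using N K w0 by (intro diff_left_mono mult_left_mono) auto
        qed
        also have "\<dots> = (N - (N - 1) * \<theta>) * (K * \<rho> (s - x) * w m)" by (simp add: algebra_simps)
        finally show ?thesis using pos[OF q(2,3)] by (simp add: g_def q m_def pos_divide_le_eq)
      qed
      then have "N \<le> N - (N - 1) * \<theta>"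
        unfolding N_def[symmetric] using v U0_pos by (subst N_def, intro cSUP_least) auto
      then show False using mult_pos_pos[of "N - 1" \<theta>] N \<theta> by linarith
    qed
    have "\<bar>\<psi>\<^sub>0 u v\<bar> \<le> N * (K * \<rho> (v - u) * w (min u v))" using u v by (intro gN) auto
    also have "\<dots> \<le> 1 * (K * \<rho> (v - u) * w (min u v))"
      using \<open>N \<le> 1\<close> pos[OF u v] by (intro mult_right_mono) auto
    finally show ?thesis by simp
  qed
  with K(1) show ?thesis using that by blast
qed

text \<open>With \<open>psi0_decay\<close> available, integrating from v = 1 costs only f \<le> 1;
  the data term is absorbed by \<open>f_le\<close> and \<open>data_decay\<close>.\<close>

lemma a0_decay:
  obtains K1 where "0 \<le> K1" "\<And>u v. - U0 \<le> u \<Longrightarrow> u \<le> v \<Longrightarrow> 1 \<le> v \<Longrightarrow> \<bar>a\<^sub>0 u v\<bar> \<le> K1 * w u"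
proof -
  obtain K where K: "0 < K" "\<And>u v. - U0 \<le> u \<Longrightarrow> 1 \<le> v \<Longrightarrow> \<bar>\<psi>\<^sub>0 u v\<bar> \<le> K * \<rho> (v - u) * w (min u v)"
    by (rule psi0_decay) blast
  obtain E where E: "0 \<le> E" "\<And>u. - U0 \<le> u \<Longrightarrow> \<rho> (1 - u) - rp \<le> E * w u"
    using data_decay by blast
  have "\<bar>a\<^sub>0 u v\<bar> \<le> (K * (1 + c) + D1 * (E / rp)) * w u" if uv: "- U0 \<le> u" "u \<le> v" "1 \<le> v" for u v
  proof -
    have "\<bar>a\<^sub>0 u v - a\<^sub>0 u 1\<bar> \<le> K * w (min u v) * (f (v - u) + c * f (min u v - u))"
      using uv K by (intro a0_growth) auto
    also have "\<dots> \<le> K * w (min u v) * (1 + c * 1)"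
      using uv K(1) w_pos[of u] c_pos by (intro mult_left_mono add_mono f_le_1) auto
    finally have "\<bar>a\<^sub>0 u v - a\<^sub>0 u 1\<bar> \<le> K * (1 + c) * w u" using uv by (simp add: algebra_simps)
    moreover have "\<bar>a\<^sub>0 u 1\<bar> \<le> D1 * (E / rp) * w u"
    proof -
      have "f (1 - u) \<le> E * w u / rp"
        using f_le[of "1 - u"] divide_right_mono[OF E(2)[OF uv(1)], of rp] rp_pos by linarith
      then have "D1 * f (1 - u) \<le> D1 * (E * w u / rp)" using D1_nonneg by (intro mult_left_mono)
      then show ?thesis using a0_data[OF uv(1)] by simp
    qed
    ultimately show ?thesis by (simp add: algebra_simps)
  qed
  moreover have "0 \<le> K * (1 + c) + D1 * (E / rp)" using K c_pos D1_nonneg E rp_pos by simp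
  ultimately show ?thesis using that by blast
qed

text \<open>The bound of \<open>psi0_decay\<close> grows with the radius. Integrating
  \<open>a\<^sub>0\<close> in \<open>u\<close> from the diagonal, where the radius is
  \<open>\<rho> 0\<close>, gives a bound uniform in \<open>v\<close> at the price of one
  power.\<close>

lemma psi0_bound:
  obtains K2 where "0 \<le> K2"
    "\<And>u v. - U0 \<le> u \<Longrightarrow> u \<le> v \<Longrightarrow> 1 \<le> v \<Longrightarrow> \<bar>\<psi>\<^sub>0 u v\<bar> \<le> K2 * (u + T) powr (1 - \<alpha>)"
proof -
  obtain K where K: "0 < K" "\<And>u v. - U0 \<le> u \<Longrightarrow> 1 \<le> v \<Longrightarrow> \<bar>\<psi>\<^sub>0 u v\<bar> \<le> K * \<rho> (v - u) * w (min u v)"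
    by (rule psi0_decay) blast
  obtain K1 where K1: "0 \<le> K1" "\<And>u v. - U0 \<le> u \<Longrightarrow> u \<le> v \<Longrightarrow> 1 \<le> v \<Longrightarrow> \<bar>a\<^sub>0 u v\<bar> \<le> K1 * w u"
    by (rule a0_decay) blast
  have "\<bar>\<psi>\<^sub>0 u v\<bar> \<le> (K * \<rho> 0 + K1 / (\<alpha> - 1)) * (u + T) powr (1 - \<alpha>)"
    if uv: "- U0 \<le> u" "u \<le> v" "1 \<le> v" for u v
  proof -
    define h where "h x = - (K1 / (\<alpha> - 1) * (x + T) powr (1 - \<alpha>))" for x
    have "\<bar>\<psi>\<^sub>0 v v - \<psi>\<^sub>0 u v\<bar> \<le> h v - h u"
    proof (rule abs_diff_le_of_deriv[OF uv(2)])
      show "((\<lambda>u. \<psi>\<^sub>0 u v) has_real_derivative a\<^sub>0 x v) (at x within {u..v})" if "x \<in> {u..v}" for x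
        using that uv by (intro has_field_derivative_subset[OF psi0_u]) auto
      show "(h has_real_derivative K1 * w x) (at x within {u..v})" if "x \<in> {u..v}" for x
      proof -
        have "0 < x + T" using that uv T_U0 by auto
        then have "((\<lambda>x. (x + T) powr (1 - \<alpha>)) has_real_derivative (1 - \<alpha>) * (x + T) powr - \<alpha>) (at x within {u..v})"
          by (auto intro!: derivative_eq_intros)
        then have "(h has_real_derivative - (K1 / (\<alpha> - 1) * ((1 - \<alpha>) * (x + T) powr - \<alpha>))) (at x within {u..v})"
          unfolding h_def[abs_def] by (intro DERIV_minus DERIV_cmult)
        moreover have "- (K1 / (\<alpha> - 1) * ((1 - \<alpha>) * y)) = K1 * y" for y
          using alpha by (simp add: divide_simps) (simp add: algebra_simps)
        ultimately show ?thesis by (simp add: w_def)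
      qed
      show "\<bar>a\<^sub>0 x v\<bar> \<le> K1 * w x" if "u < x" "x < v" for x using that uv by (intro K1) auto
    qed
    moreover have "h v \<le> 0" using K1 alpha by (simp add: h_def)
    moreover have "\<bar>\<psi>\<^sub>0 v v\<bar> \<le> K * \<rho> 0 * (u + T) powr (1 - \<alpha>)"
    proof -
      have "\<bar>\<psi>\<^sub>0 v v\<bar> \<le> K * \<rho> 0 * w v" using K(2)[of v v] uv by simp
      also have "\<dots> \<le> K * \<rho> 0 * (u + T) powr (1 - \<alpha>)"
      proof (rule mult_left_mono)
        have "w v \<le> w u" using uv by (intro w_mono) auto
        also have "w u \<le> (u + T) powr (1 - \<alpha>)" unfolding w_def using uv T_U0 by (intro powr_mono) auto
        finally show "w v \<le> (u + T) powr (1 - \<alpha>)" .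
      qed (use K rho_pos[of 0] in auto)
      finally show ?thesis .
    qed
    ultimately show ?thesis by (simp add: h_def algebra_simps)
  qed
  moreover have "0 \<le> K * \<rho> 0 + K1 / (\<alpha> - 1)" using K(1) rho_pos[of 0] K1(1) alpha by simp
  ultimately show ?thesis using that by blast
qed

text \<open>Constants have infinite radiation field, while the data bounds make the radiation field finite
  on the initial cone.\<close>

lemma phi_limit_zero: "\<phi>\<^sub>0 = 0"
proof (rule ccontr)
  assume nz: "\<phi>\<^sub>0 \<noteq> 0"
  obtain K2 where K2: "0 \<le> K2"
    "\<And>u v. - U0 \<le> u \<Longrightarrow> u \<le> v \<Longrightarrow> 1 \<le> v \<Longrightarrow> \<bar>\<psi>\<^sub>0 u v\<bar> \<le> K2 * (u + T) powr (1 - \<alpha>)"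
    by (rule psi0_bound) blast
  \<comment> \<open>The variation of \<psi> along the initial cone, its value at v = 1 and the bound
    for \<open>\<psi>\<^sub>0\<close>: all independent of \<open>v\<close>, whereas the radius is
    unbounded.\<close>
  define B where "B = \<bar>D\<bar> / (2 * rp\<^sup>2) + \<bar>\<psi> (- U0) 1\<bar> + K2 * (- U0 + T) powr (1 - \<alpha>)"
  have "\<bar>\<phi>\<^sub>0\<bar> * \<rho> (v + U0) \<le> B" if v: "1 \<le> v" for v
  proof -
    define h where "h s = - (\<bar>D\<bar> / (2 * (\<rho> (s - - U0))\<^sup>2))" for s
    have "\<bar>\<psi> (- U0) v - \<psi> (- U0) 1\<bar> \<le> h v - h 1"
    proof (rule abs_diff_le_of_deriv[OF v])
      show "((\<lambda>v. \<psi> (- U0) v) has_real_derivative b (- U0) s) (at s within {1..v})" if "s \<in> {1..v}" for s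
        using that by (intro has_field_derivative_subset[OF psi_v]) auto
      show "(h has_real_derivative \<bar>D\<bar> * (f (s + U0) / \<rho> (s + U0) ^ 3)) (at s within {1..v})" for s
        unfolding h_def[abs_def] using uminus_inverse_rho_sq_v[of "\<bar>D\<bar>" "- U0" s] by simp
      show "\<bar>b (- U0) s\<bar> \<le> \<bar>D\<bar> * (f (s + U0) / \<rho> (s + U0) ^ 3)" if "1 < s" for s
      proof -
        have "D * (f (s + U0) / \<rho> (s + U0) ^ 3) \<le> \<bar>D\<bar> * (f (s + U0) / \<rho> (s + U0) ^ 3)"
          using f_pos[of "s + U0"] rho_pos[of "s + U0"] by (intro mult_right_mono) auto
        then show ?thesis using data_v[of s] that by linarith
      qed
    qed
    moreover have "h v \<le> 0" by (simp add: h_def)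
    moreover have "- h 1 \<le> \<bar>D\<bar> / (2 * rp\<^sup>2)"
      unfolding h_def using rho_gt[of "1 - - U0"] rp_pos by (auto intro!: divide_left_mono power_mono)
    moreover have "\<bar>\<psi>\<^sub>0 (- U0) v\<bar> \<le> K2 * (- U0 + T) powr (1 - \<alpha>)"
      using v U0_pos by (intro K2) auto
    moreover have "\<bar>\<phi>\<^sub>0\<bar> * \<rho> (v + U0) = \<bar>\<psi> (- U0) v - \<psi>\<^sub>0 (- U0) v\<bar>"
      using rho_pos[of "v + U0"] by (simp add: \<psi>\<^sub>0_def abs_mult)
    ultimately show ?thesis unfolding B_def by linarith
  qed
  moreover have "\<exists>x\<ge>1 + U0. \<rho> x > B / \<bar>\<phi>\<^sub>0\<bar>"
  proof -
    have "\<forall>\<^sub>F x in at_top. \<rho> x > B / \<bar>\<phi>\<^sub>0\<bar> \<and> 1 + U0 \<le> x"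
      by (intro eventually_conj eventually_ge_at_top)
         (use rho_at_top in \<open>auto simp: filterlim_at_top_dense\<close>)
    then show ?thesis using eventually_happens'[OF trivial_limit_at_top_linorder] by blast
  qed
  then obtain x where "1 + U0 \<le> x" "B / \<bar>\<phi>\<^sub>0\<bar> < \<rho> x" by blast
  ultimately show False using nz by (force simp: divide_less_eq mult.commute dest: spec[of _ "x - U0"])
qed

subsection \<open>Asymptotics along the diagonal\<close>

lemma psi0_eq: "\<psi>\<^sub>0 = \<psi>"
  unfolding \<psi>\<^sub>0_def[abs_def] by (simp add: phi_limit_zero)

lemma a0_eq: "a\<^sub>0 = a"
  unfolding a\<^sub>0_def[abs_def] by (simp add: phi_limit_zero)

lemmas psi_decay = psi0_decay[unfolded psi0_eq]
  and a_decay = a0_decay[unfolded a0_eq]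
  and psi_bound = psi0_bound[unfolded psi0_eq]

text \<open>Integrates the equation in \<open>u\<close> from the initial cone, with V \<le> 2M / r^3
  and the radius smallest at the final \<open>u\<close>. The factor f / f 0 \<ge> 1 is inserted to
  match \<open>uminus_inverse_rho_sq_v\<close>.\<close>

lemma b_bound:
  assumes u: "- U0 \<le> u"
  obtains B where "0 \<le> B" "\<And>s. max 1 u \<le> s \<Longrightarrow> \<bar>b u s\<bar> \<le> B * (f (s - u) / \<rho> (s - u) ^ 3)"
proof -
  obtain K2 where K2: "0 \<le> K2"
    "\<And>u v. - U0 \<le> u \<Longrightarrow> u \<le> v \<Longrightarrow> 1 \<le> v \<Longrightarrow> \<bar>\<psi> u v\<bar> \<le> K2 * (u + T) powr (1 - \<alpha>)"
    by (rule psi_bound) blast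
  define B where "B = \<bar>D\<bar> + 2 * M * K2 * (u + U0)"
  have B: "0 \<le> B" using M_pos K2(1) u by (simp add: B_def)
  have "\<bar>b u s\<bar> \<le> B / f 0 * (f (s - u) / \<rho> (s - u) ^ 3)" if s: "max 1 u \<le> s" for s
  proof -
    define R where "R = \<rho> (s - u) ^ 3"
    have R: "0 < R" by (simp add: R_def rho_pos)
    define h where "h x = 2 * M * K2 / R * x" for x
    have "\<bar>b u s - b (- U0) s\<bar> \<le> h u - h (- U0)"
    proof (rule abs_diff_le_of_deriv[OF u])
      show "((\<lambda>u. b u s) has_real_derivative - (V (s - x) * \<psi> x s)) (at x within {- U0..u})"
        if "x \<in> {- U0..u}" for x
        using that s by (intro has_field_derivative_subset[OF b_u]) auto
      show "(h has_real_derivative 2 * M * K2 / R) (at x within {- U0..u})" for x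
        unfolding h_def[abs_def] using R by (auto intro!: derivative_eq_intros)
      show "\<bar>- (V (s - x) * \<psi> x s)\<bar> \<le> 2 * M * K2 / R" if x: "- U0 < x" "x < u" for x
      proof -
        have "(x + T) powr (1 - \<alpha>) \<le> (x + T) powr 0" using x T_U0 alpha by (intro powr_mono) auto
        then have "(x + T) powr (1 - \<alpha>) \<le> 1" using x T_U0 by simp
        then have "K2 * (x + T) powr (1 - \<alpha>) \<le> K2 * 1" using K2 by (intro mult_left_mono)
        then have psi: "\<bar>\<psi> x s\<bar> \<le> K2" using K2(2)[of x s] x s by auto
        have "V (s - x) \<le> 2 * M / \<rho> (s - x) ^ 3" by (rule V_le)
        also have "\<dots> \<le> 2 * M / R"
          unfolding R_def using M_pos rho_pos[of "s - u"] rho_pos[of "s - x"] x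
          by (intro divide_left_mono power_mono) (auto simp: rho_le_iff)
        finally have "V (s - x) * \<bar>\<psi> x s\<bar> \<le> 2 * M / R * K2"
          using psi V_nonneg M_pos R by (intro mult_mono) auto
        then show ?thesis using V_nonneg[of "s - x"] by (simp add: abs_mult)
      qed
    qed
    also have "h u - h (- U0) = 2 * M * K2 * (u + U0) / R" by (simp add: h_def algebra_simps add_divide_distrib)
    finally have 1: "\<bar>b u s - b (- U0) s\<bar> \<le> 2 * M * K2 * (u + U0) / R" .
    have "\<bar>b (- U0) s\<bar> \<le> \<bar>D\<bar> / R"
    proof -
      have "\<bar>b (- U0) s\<bar> \<le> D * (f (s + U0) / \<rho> (s + U0) ^ 3)" using s by (intro data_v) auto
      also have "\<dots> \<le> \<bar>D\<bar> * (1 / R)"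
      proof (intro mult_mono frac_le f_le_1 abs_ge_self)
        show "R \<le> \<rho> (s + U0) ^ 3"
          unfolding R_def using u rho_pos[of "s - u"] by (intro power_mono) (auto simp: rho_le_iff)
      qed (use R f_pos[of "s + U0"] rho_pos[of "s + U0"] in auto)
      finally show ?thesis by simp
    qed
    with 1 have "\<bar>b u s\<bar> \<le> \<bar>D\<bar> / R + 2 * M * K2 * (u + U0) / R" by linarith
    also have "\<dots> = B / R" by (simp add: B_def add_divide_distrib)
    also have "\<dots> \<le> B / R * (f (s - u) / f 0)"
    proof -
      have "1 \<le> f (s - u) / f 0" using f_pos[of 0] f_mono[of 0 "s - u"] s by simp
      then have "B / R * 1 \<le> B / R * (f (s - u) / f 0)" using B R by (intro mult_left_mono) auto
      then show ?thesis by simp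
    qed
    finally show ?thesis by (simp add: R_def mult.commute)
  qed
  moreover have "0 \<le> B / f 0" using B f_pos[of 0] by simp
  ultimately show ?thesis using that by blast
qed

text \<open>\<open>b_bound\<close> makes the oscillation of r\<phi> beyond v of order 1 / r^2, so
  the \<open>Lim\<close> in the definition is a genuine limit.\<close>

lemma radiation_field_tendsto:
  assumes u: "- U0 \<le> u"
  shows "((\<lambda>v. \<psi> u v) \<longlongrightarrow> radiation_field M e \<phi> u) at_top"
proof -
  obtain B where B: "0 \<le> B" "\<And>s. max 1 u \<le> s \<Longrightarrow> \<bar>b u s\<bar> \<le> B * (f (s - u) / \<rho> (s - u) ^ 3)"
    using b_bound[OF u] by blast
  define \<eta> where "\<eta> x = B / 2 * (inverse (\<rho> (x - u)))\<^sup>2" for x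
  have \<eta>_eq: "\<eta> x = B / (2 * (\<rho> (x - u))\<^sup>2)" for x
    using rho_pos[of "x - u"] by (simp add: \<eta>_def power_one_over inverse_eq_divide)
  have bd: "\<bar>\<psi> u y - \<psi> u x\<bar> \<le> \<eta> x" if xy: "max 1 u \<le> x" "x \<le> y" for x y
  proof -
    have "\<bar>\<psi> u y - \<psi> u x\<bar> \<le> - \<eta> y - (- \<eta> x)"
      unfolding \<eta>_eq
    proof (rule abs_diff_le_of_deriv[OF xy(2) _ uminus_inverse_rho_sq_v])
      show "((\<lambda>v. \<psi> u v) has_real_derivative b u s) (at s within {x..y})" if "s \<in> {x..y}" for s
        using that xy u by (intro has_field_derivative_subset[OF psi_v]) auto
      show "\<bar>b u s\<bar> \<le> B * (f (s - u) / \<rho> (s - u) ^ 3)" if "x < s" for s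
        using that xy by (intro B(2)) auto
    qed
    moreover have "0 \<le> \<eta> y" using B by (simp add: \<eta>_def)
    ultimately show ?thesis by linarith
  qed
  have "((\<lambda>x. inverse (\<rho> (x - u))) \<longlongrightarrow> 0) at_top"
    by (intro tendsto_inverse_0_at_top filterlim_compose[OF rho_at_top shift_at_top])
  then have "((\<lambda>x. B / 2 * (inverse (\<rho> (x - u)))\<^sup>2) \<longlongrightarrow> B / 2 * 0\<^sup>2) at_top"
    by (intro tendsto_intros)
  then have "(\<eta> \<longlongrightarrow> 0) at_top" unfolding \<eta>_def by simp
  from convergent_of_cauchy_bound[OF bd this]
  obtain L where L: "((\<lambda>v. \<psi> u v) \<longlongrightarrow> L) at_top" by blast
  then have "radiation_field M e \<phi> u = L"
    unfolding radiation_field_def rphi_ext_eq[abs_def] by (rule tendsto_Lim[OF trivial_limit_at_top_linorder])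
  with L show ?thesis by simp
qed

text \<open>The radius on the initial cone, as in \<open>data_at_infinity\<close>. It does not
  depend on \<open>u\<close> and so passes through integrals in \<open>u\<close>.\<close>

abbreviation R :: "real \<Rightarrow> real" where "R v \<equiv> \<rho> (v + U0)"

text \<open>Needed for domination. Here v - u \<ge> v / 2, and \<open>\<rho> (v / 2)\<close>
  controls itself, v / 2 by linear growth, and \<open>U0\<close> because it exceeds
  \<open>rp\<close>: the three summands of \<open>C\<close>.\<close>

lemma R_le:
  obtains C where "0 < C" "\<And>v u. 0 \<le> v \<Longrightarrow> u \<le> v / 2 \<Longrightarrow> R v \<le> C * \<rho> (v - u)"
proof -
  define C where "C = 1 + 1 / f 0 + U0 / rp"
  have "R v \<le> C * \<rho> (v - u)" if v: "0 \<le> v" "u \<le> v / 2" for u v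
  proof -
    have "R v - \<rho> (v / 2) \<le> v / 2 + U0" using rho_diff[of "v / 2" "v + U0"] v U0_pos by simp
    moreover have "v / 2 \<le> 1 / f 0 * \<rho> (v / 2)"
      using rho_lower[of "v / 2"] rho_pos[of 0] v f_pos[of 0] by (simp add: field_simps)
    moreover have "U0 \<le> U0 / rp * \<rho> (v / 2)"
      using mult_left_mono[OF less_imp_le[OF rho_gt[of "v / 2"]], of "U0 / rp"] U0_pos rp_pos by simp
    ultimately have "R v \<le> C * \<rho> (v / 2)" by (simp add: C_def algebra_simps)
    also have "\<dots> \<le> C * \<rho> (v - u)"
      using v U0_pos rp_pos f_pos[of 0] by (intro mult_left_mono) (auto simp: C_def rho_le_iff)
    finally show ?thesis .
  qed
  moreover have "0 < C" using f_pos[of 0] U0_pos rp_pos by (simp add: C_def add_pos_nonneg)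
  ultimately show ?thesis using that by blast
qed

text \<open>The two radii differ by at most u + U0, while both tend to infinity.\<close>

lemma R_ratio: "((\<lambda>v. R v / \<rho> (v - u)) \<longlongrightarrow> 1) at_top" if u: "- U0 \<le> u"
proof -
  have "((\<lambda>x. inverse (\<rho> (x - u))) \<longlongrightarrow> 0) at_top"
    by (intro tendsto_inverse_0_at_top filterlim_compose[OF rho_at_top shift_at_top])
  then have "((\<lambda>x. 1 + (u + U0) * inverse (\<rho> (x - u))) \<longlongrightarrow> 1 + (u + U0) * 0) at_top"
    by (intro tendsto_intros)
  then have up: "((\<lambda>x. 1 + (u + U0) * inverse (\<rho> (x - u))) \<longlongrightarrow> 1) at_top" by simp
  show ?thesis
  proof (rule tendsto_sandwich[OF _ _ tendsto_const up]; intro always_eventually allI)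
    fix v
    have r: "0 < \<rho> (v - u)" by (rule rho_pos)
    show "1 \<le> R v / \<rho> (v - u)" using r u by (simp add: rho_le_iff)
    have "R v \<le> \<rho> (v - u) + (u + U0)" using rho_diff[of "v - u" "v + U0"] u by simp
    then show "R v / \<rho> (v - u) \<le> 1 + (u + U0) * inverse (\<rho> (v - u))" using r by (simp add: field_simps)
  qed
qed

lemma kernel_limit:
  assumes u: "- U0 \<le> u"
  shows "((\<lambda>v. R v ^ 3 * (V (v - u) * \<psi> u v)) \<longlongrightarrow> 2 * M * radiation_field M e \<phi> u) at_top"
proof -
  have "((\<lambda>v. (R v / \<rho> (v - u)) ^ 3 * (V (v - u) * \<rho> (v - u) ^ 3) * \<psi> u v)
      \<longlongrightarrow> 1 ^ 3 * (2 * M) * radiation_field M e \<phi> u) at_top"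
    by (intro tendsto_intros R_ratio radiation_field_tendsto u filterlim_compose[OF V_rho_cube shift_at_top])
  moreover have "(R v / \<rho> (v - u)) ^ 3 * (V (v - u) * \<rho> (v - u) ^ 3) * \<psi> u v = R v ^ 3 * (V (v - u) * \<psi> u v)" for v
    using rho_pos[of "v - u"] by (simp add: power_divide)
  ultimately show ?thesis by simp
qed

text \<open>The dominating function; it is integrable because 1 - \<alpha> < - 1.\<close>

lemma integrable_weight: "integrable lborel (\<lambda>u. indicator {- U0..} u * (u + T) powr (1 - \<alpha>))"
proof (rule integrableI_nonneg)
  let ?g = "\<lambda>u. (u + T) powr (1 - \<alpha>)"
  let ?G = "\<lambda>u. 1 / (2 - \<alpha>) * (u + T) powr (2 - \<alpha>)"
  show "(\<lambda>u. indicator {- U0..} u * ?g u) \<in> borel_measurable lborel" by measurable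
  have "(\<integral>\<^sup>+u. ennreal (indicator {- U0..} u * ?g u) \<partial>lborel) = (\<integral>\<^sup>+u. ennreal (?g u) * indicator {- U0..} u \<partial>lborel)"
    by (intro nn_integral_cong) (auto split: split_indicator)
  also have "\<dots> = ennreal (0 - ?G (- U0))"
  proof (rule nn_integral_FTC_atLeast)
    show "?g \<in> borel_measurable borel" by measurable
    show "(?G has_real_derivative ?g x) (at x)" if "- U0 \<le> x" for x
      using that T_U0 alpha by (auto intro!: derivative_eq_intros)
    have "filterlim (\<lambda>u. u + T) at_top at_top"
      using shift_at_top[of "- T"] by simp
    then have "((\<lambda>u. (u + T) powr (2 - \<alpha>)) \<longlongrightarrow> 0) at_top" using alpha by (intro tendsto_neg_powr) auto
    then show "(?G \<longlongrightarrow> 0) at_top" by (intro tendsto_mult_right_zero)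
  qed auto
  finally show "(\<integral>\<^sup>+u. ennreal (indicator {- U0..} u * ?g u) \<partial>lborel) < \<infinity>" by simp
qed auto

text \<open>By \<open>b_u\<close> the difference is an integral of V \<psi> over [- U0, v / 2].
  Dominated convergence applies: \<open>kernel_limit\<close> is the pointwise limit, and
  \<open>V_le\<close>, \<open>R_le\<close> and \<open>psi_bound\<close> bound the integrand by a
  multiple of (u + T) powr (1 - \<alpha>).\<close>

lemma kernel_integral_limit:
  "((\<lambda>v. R v ^ 3 * (b (- U0) v - b (v / 2) v)) \<longlongrightarrow> (LINT u:{- U0..}|lborel. 2 * M * radiation_field M e \<phi> u)) at_top"
proof -
  \<comment> \<open>\<open>max 2 v\<close> keeps the integrand on the domain of \<psi>, hence
    measurable, for every real index; nothing changes for v \<ge> 2.\<close>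
  define s where "s v u = (let v = max 2 v in indicator {- U0..v / 2} u *\<^sub>R (R v ^ 3 * (V (v - u) * \<psi> u v)))" for v u
  define g where "g u = indicator {- U0..} u *\<^sub>R (2 * M * radiation_field M e \<phi> u)" for u
  obtain C where C: "0 < C" "\<And>v u. 0 \<le> v \<Longrightarrow> u \<le> v / 2 \<Longrightarrow> R v \<le> C * \<rho> (v - u)"
    by (rule R_le) blast
  obtain K2 where K2: "0 \<le> K2"
    "\<And>u v. - U0 \<le> u \<Longrightarrow> u \<le> v \<Longrightarrow> 1 \<le> v \<Longrightarrow> \<bar>\<psi> u v\<bar> \<le> K2 * (u + T) powr (1 - \<alpha>)"
    by (rule psi_bound) blast
  have cont: "continuous_on {- U0..v / 2} (\<lambda>u. V (v - u) * \<psi> u v)" if "1 \<le> v" for v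
    using that by (intro cont_section_u[OF Vpsi_cont]) auto
  have meas: "s v \<in> borel_measurable lborel" for v
    unfolding s_def Let_def measurable_lborel2
    by (intro borel_measurable_continuous_on_indicator continuous_intros cont) auto
  have lim: "((\<lambda>v. s v u) \<longlongrightarrow> g u) at_top" for u
  proof (cases "- U0 \<le> u")
    case True
    show ?thesis unfolding g_def
    proof (rule Lim_transform_eventually)
      show "((\<lambda>v. R v ^ 3 * (V (v - u) * \<psi> u v)) \<longlongrightarrow> indicator {- U0..} u *\<^sub>R (2 * M * radiation_field M e \<phi> u)) at_top"
        using kernel_limit[OF True] True by simp
      show "\<forall>\<^sub>F v in at_top. R v ^ 3 * (V (v - u) * \<psi> u v) = s v u"
        using eventually_ge_at_top[of "max 2 (2 * u)"] by eventually_elim (use True in \<open>auto simp: s_def\<close>)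
    qed
  next
    case False
    then show ?thesis by (simp add: s_def g_def)
  qed
  have "((\<lambda>v. integral\<^sup>L lborel (s v)) \<longlongrightarrow> integral\<^sup>L lborel g) at_top"
  proof (rule integral_dominated_convergence_at_top)
    have seq: "filterlim real at_top sequentially" by (rule filterlim_real_sequentially)
    \<comment> \<open>The radiation field is measurable as a pointwise limit along the
      integers.\<close>
    show "g \<in> borel_measurable lborel"
      by (rule borel_measurable_LIMSEQ_real[where u = "\<lambda>n. s (real n)"], rule filterlim_compose[OF lim seq], rule meas)
    show "integrable lborel (\<lambda>u. 2 * M * C ^ 3 * K2 * (indicator {- U0..} u * (u + T) powr (1 - \<alpha>)))"
      by (intro integrable_mult_right integrable_weight)
    show "\<forall>\<^sub>F v in at_top. AE u in lborel. norm (s v u) \<le> 2 * M * C ^ 3 * K2 * (indicator {- U0..} u * (u + T) powr (1 - \<alpha>))"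
      using eventually_ge_at_top[of 2]
    proof eventually_elim
      case (elim v)
      have "norm (s v u) \<le> 2 * M * C ^ 3 * K2 * (indicator {- U0..} u * (u + T) powr (1 - \<alpha>))" for u
      proof (cases "u \<in> {- U0..v / 2}")
        case True
        have r: "0 < \<rho> (v - u)" by (rule rho_pos)
        have "R v ^ 3 * V (v - u) \<le> (C * \<rho> (v - u)) ^ 3 * (2 * M / \<rho> (v - u) ^ 3)"
          using True elim rho_pos[of "v + U0"] r C by (intro mult_mono power_mono V_le V_nonneg) auto
        also have "\<dots> = 2 * M * C ^ 3" using r by (simp add: power_mult_distrib)
        finally have 1: "R v ^ 3 * V (v - u) \<le> 2 * M * C ^ 3" .
        have 2: "\<bar>\<psi> u v\<bar> \<le> K2 * (u + T) powr (1 - \<alpha>)" using True elim by (intro K2) auto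
        have "norm (s v u) = (R v ^ 3 * V (v - u)) * \<bar>\<psi> u v\<bar>"
          using True elim rho_pos[of "v + U0"] V_nonneg[of "v - u"] by (simp add: s_def abs_mult)
        also have "\<dots> \<le> (2 * M * C ^ 3) * (K2 * (u + T) powr (1 - \<alpha>))"
          by (rule mult_mono[OF 1 2]) (use M_pos C in auto)
        finally show ?thesis using True by simp
      next
        case False
        then show ?thesis using elim M_pos C K2 by (simp add: s_def)
      qed
      then show ?case by simp
    qed
  qed (rule meas | simp add: lim)+
  then have "((\<lambda>v. R v ^ 3 * (b (- U0) v - b (v / 2) v)) \<longlongrightarrow> integral\<^sup>L lborel g) at_top"
  proof (rule Lim_transform_eventually)
    show "\<forall>\<^sub>F v in at_top. integral\<^sup>L lborel (s v) = R v ^ 3 * (b (- U0) v - b (v / 2) v)"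
      using eventually_ge_at_top[of 2]
    proof eventually_elim
      case (elim v)
      have "integral\<^sup>L lborel (\<lambda>u. indicator {- U0..v / 2} u *\<^sub>R (R v ^ 3 * (V (v - u) * \<psi> u v)))
          = - (R v ^ 3) * b (v / 2) v - (- (R v ^ 3) * b (- U0) v)"
      proof (rule integral_FTC_Icc)
        fix x assume x: "- U0 \<le> x" "x \<le> v / 2"
        have "((\<lambda>u. - (R v ^ 3) * b u v) has_real_derivative - (R v ^ 3) * - (V (v - x) * \<psi> x v)) (at x within {- U0..v / 2})"
          using x elim by (intro DERIV_cmult has_field_derivative_subset[OF b_u]) auto
        then show "((\<lambda>u. - (R v ^ 3) * b u v) has_vector_derivative R v ^ 3 * (V (v - x) * \<psi> x v)) (at x within {- U0..v / 2})"
          by (simp add: has_real_derivative_iff_has_vector_derivative)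
      qed (use elim U0_pos in \<open>auto intro!: continuous_on_mult_left cont\<close>)
      moreover have "s v = (\<lambda>u. indicator {- U0..v / 2} u *\<^sub>R (R v ^ 3 * (V (v - u) * \<psi> u v)))"
        using elim by (simp add: s_def[abs_def])
      ultimately have "integral\<^sup>L lborel (s v) = - (R v ^ 3) * b (v / 2) v - (- (R v ^ 3) * b (- U0) v)"
        by (simp only:)
      then show ?case by (simp add: right_diff_distrib)
    qed
  qed
  then show ?thesis unfolding g_def[abs_def] set_lebesgue_integral_def .
qed

text \<open>The two terms of \<open>frakL\<close> are the limit on the initial cone and what the
  potential removes between u = - U0 and u = v / 2.\<close>

lemma b_limit: "((\<lambda>v. R v ^ 3 * b (v / 2) v) \<longlongrightarrow> frakL M e U0 \<phi>) at_top"
proof -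
  obtain l where l: "(data_at_infinity M e U0 \<phi> \<longlongrightarrow> l) at_top" using limit by (auto simp: limit_condition_def)
  then have L: "frakL M e U0 \<phi> = l - (LINT u:{- U0..}|lborel. 2 * M * radiation_field M e \<phi> u)"
    unfolding frakL_def by (subst tendsto_Lim[OF _ l]) auto
  have "((\<lambda>v. R v ^ 3 * b (- U0) v) \<longlongrightarrow> l) at_top"
    by (rule Lim_transform_eventually[OF l])
       (use eventually_ge_at_top[of 1] in eventually_elim, simp add: data_at_infinity_def null_derivs r_ext_eq)
  from tendsto_diff[OF this kernel_integral_limit] show ?thesis
    unfolding L by (simp add: algebra_simps)
qed

text \<open>Here \<alpha> > 3 enters: A + v is at most (A + 2) (v / 2 + T), which leaves the
  negative power 3 - \<alpha>.\<close>

lemma cubic_weight_zero: "((\<lambda>v. (A + v) ^ 3 * w (v / 2)) \<longlongrightarrow> 0) at_top" if A: "0 \<le> A"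
proof (rule tendsto_sandwich[of "\<lambda>_. 0"])
  have "filterlim (\<lambda>v. T + v * (1 / 2)) at_top at_top"
    by (intro filterlim_tendsto_add_at_top[OF tendsto_const] filterlim_at_top_mult_tendsto_pos[OF tendsto_const] filterlim_ident) auto
  then have "filterlim (\<lambda>v. v / 2 + T) at_top at_top" by (simp add: add.commute)
  then have "((\<lambda>v. (v / 2 + T) powr (3 - \<alpha>)) \<longlongrightarrow> 0) at_top" using alpha by (intro tendsto_neg_powr) auto
  then show "((\<lambda>v. (A + 2) ^ 3 * (v / 2 + T) powr (3 - \<alpha>)) \<longlongrightarrow> 0) at_top"
    by (rule tendsto_mult_right_zero)
  show "\<forall>\<^sub>F v in at_top. (A + v) ^ 3 * w (v / 2) \<le> (A + 2) ^ 3 * (v / 2 + T) powr (3 - \<alpha>)"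
    using eventually_ge_at_top[of 0]
  proof eventually_elim
    case (elim v)
    have pos: "0 < v / 2 + T" using elim T_ge by simp
    have "A * 1 \<le> A * (v / 2 + T)" using A elim T_ge by (intro mult_left_mono) auto
    moreover have "(A + 2) * (v / 2 + T) = A * (v / 2 + T) + v + 2 * T" by (simp add: field_simps)
    ultimately have "A + v \<le> (A + 2) * (v / 2 + T)" using T_ge by linarith
    then have "(A + v) ^ 3 \<le> ((A + 2) * (v / 2 + T)) ^ 3" using A elim by (intro power_mono) auto
    then have "(A + v) ^ 3 * w (v / 2) \<le> ((A + 2) * (v / 2 + T)) ^ 3 * w (v / 2)"
      by (intro mult_right_mono) (auto simp: w_def)
    also have "\<dots> = (A + 2) ^ 3 * (v / 2 + T) powr (3 - \<alpha>)"
      using pos powr_add[of "v / 2 + T" 3 "- \<alpha>"] unfolding w_def power_mult_distrib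
      by (simp add: mult.assoc)
    finally show ?case .
  qed
  show "\<forall>\<^sub>F v in at_top. 0 \<le> (A + v) ^ 3 * w (v / 2)"
    using eventually_ge_at_top[of 0] by eventually_elim (use A in \<open>auto simp: w_def\<close>)
qed simp

section \<open>From u = v / 2 to the diagonal\<close>

lemma R_le_linear: "0 \<le> v \<Longrightarrow> R v \<le> \<rho> 0 + U0 + v"
  using rho_diff[of 0 "v + U0"] U0_pos by simp

lemma R_cube_zero:
  assumes g: "\<And>v. 2 \<le> v \<Longrightarrow> \<bar>g v\<bar> \<le> C * w (v / 2)" and C: "0 \<le> C"
  shows "((\<lambda>v. R v ^ 3 * g v) \<longlongrightarrow> 0) at_top"
proof (rule Lim_null_comparison)
  have "0 \<le> \<rho> 0 + U0" using rho_pos[of 0] U0_pos by simp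
  from tendsto_mult_right_zero[OF cubic_weight_zero[OF this], of C]
  show "((\<lambda>v. C * ((\<rho> 0 + U0 + v) ^ 3 * w (v / 2))) \<longlongrightarrow> 0) at_top" .
  show "\<forall>\<^sub>F v in at_top. norm (R v ^ 3 * g v) \<le> C * ((\<rho> 0 + U0 + v) ^ 3 * w (v / 2))"
    using eventually_ge_at_top[of 2]
  proof eventually_elim
    case (elim v)
    have "norm (R v ^ 3 * g v) = R v ^ 3 * \<bar>g v\<bar>" using rho_pos[of "v + U0"] by (simp add: abs_mult)
    also have "\<dots> \<le> (\<rho> 0 + U0 + v) ^ 3 * (C * w (v / 2))"
      using elim rho_pos[of "v + U0"] R_le_linear[of v] by (intro mult_mono power_mono g) auto
    finally show ?case by (simp add: mult.left_commute)
  qed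
qed

text \<open>Close to the diagonal the radius is no longer comparable to \<open>R v\<close>, so
  domination fails. Instead \<open>psi_decay\<close> supplies the small factor
  \<open>w (v / 2)\<close>, and V r = f' integrates to at most 1.\<close>

lemma b_diagonal_limit: "((\<lambda>v. R v ^ 3 * b v v) \<longlongrightarrow> frakL M e U0 \<phi>) at_top"
proof -
  obtain K where K: "0 < K" "\<And>u v. - U0 \<le> u \<Longrightarrow> 1 \<le> v \<Longrightarrow> \<bar>\<psi> u v\<bar> \<le> K * \<rho> (v - u) * w (min u v)"
    by (rule psi_decay) blast
  have "\<bar>b v v - b (v / 2) v\<bar> \<le> K * w (v / 2)" if v: "2 \<le> v" for v
  proof -
    let ?h = "\<lambda>u. - (K * w (v / 2) * f (v - u))"
    have wpos: "0 < w (v / 2)" using v U0_pos by (intro w_pos) auto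
    have "\<bar>b v v - b (v / 2) v\<bar> \<le> ?h v - ?h (v / 2)"
    proof (rule abs_diff_le_of_deriv)
      show "((\<lambda>u. b u v) has_real_derivative - (V (v - x) * \<psi> x v)) (at x within {v / 2..v})"
        if "x \<in> {v / 2..v}" for x
        using that v U0_pos by (intro has_field_derivative_subset[OF b_u]) auto
      show "(?h has_real_derivative - (K * w (v / 2) * - f' (v - x))) (at x within {v / 2..v})" for x
        by (intro DERIV_minus DERIV_cmult f_u)
      show "\<bar>- (V (v - x) * \<psi> x v)\<bar> \<le> - (K * w (v / 2) * - f' (v - x))" if x: "v / 2 < x" "x < v" for x
      proof -
        have "\<bar>\<psi> x v\<bar> \<le> K * \<rho> (v - x) * w x" using K(2)[of x v] x v U0_pos by auto
        also have "\<dots> \<le> K * \<rho> (v - x) * w (v / 2)"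
          using K(1) rho_pos[of "v - x"] x v U0_pos by (intro mult_left_mono w_mono) auto
        finally have "V (v - x) * \<bar>\<psi> x v\<bar> \<le> V (v - x) * (K * \<rho> (v - x) * w (v / 2))"
          by (intro mult_left_mono V_nonneg)
        also have "\<dots> = K * w (v / 2) * (V (v - x) * \<rho> (v - x))" by (simp add: mult_ac)
        finally show ?thesis using V_nonneg[of "v - x"] by (simp add: abs_mult V_rho)
      qed
    qed (use v in auto)
    also have "\<dots> \<le> K * w (v / 2) * f (v - v / 2)"
      using K(1) wpos f_pos[of 0] by simp
    also have "\<dots> \<le> K * w (v / 2)" using K(1) wpos f_le_1 by (intro mult_left_le) auto
    finally show ?thesis .
  qed
  then have "((\<lambda>v. R v ^ 3 * (b v v - b (v / 2) v)) \<longlongrightarrow> 0) at_top"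
    using K(1) by (intro R_cube_zero) auto
  from tendsto_add[OF b_limit this] show ?thesis by (simp add: algebra_simps)
qed

text \<open>The diagonal is the curve of constant radius \<open>\<rho> 0\<close>. Its tangent (1, 0)
  is the sum of the null directions (0, - f 0) and (1, f 0), and the terms with f \<phi> in
  \<open>a\<close> and \<open>b\<close> cancel.\<close>

lemma psi_diagonal_deriv:
  assumes v: "1 < v"
  shows "((\<lambda>v. \<psi> v v) has_real_derivative a v v + b v v) (at v)"
proof -
  have "((\<lambda>v. (v, \<rho> 0)) has_derivative (\<lambda>h. (h, 0))) (at v within {1..})"
    by (intro has_derivative_Pair has_derivative_ident has_derivative_const)
  moreover have "(\<lambda>v. (v, \<rho> 0)) ` {1..} \<subseteq> region M e U0"
  proof (rule image_subsetI)
    fix x :: real assume "x \<in> {1..}"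
    then show "(x, \<rho> 0) \<in> region M e U0" using p_region[of x x] U0_pos by (simp add: p_def)
  qed
  ultimately have d: "((\<lambda>v. \<phi> (v, \<rho> 0)) has_derivative (\<lambda>h. blinfun_apply (G (v, \<rho> 0)) (h, 0))) (at v within {1..})"
    by (intro has_derivative_in_compose2[OF phi_deriv]) (use v in auto)
  define g' where "g' = blinfun_apply (G (v, \<rho> 0)) (1, 0)"
  have "blinfun_apply (G (v, \<rho> 0)) (h, 0) = g' * h" for h
    using blinfun.scaleR_right[of "G (v, \<rho> 0)" h "(1, 0)"] by (simp add: g'_def mult.commute)
  with d have "((\<lambda>v. \<phi> (v, \<rho> 0)) has_real_derivative g') (at v within {1..})"
    by (simp add: has_field_derivative_def)
  moreover have "at v within {1..} = at v" using v by (intro at_within_interior) auto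
  ultimately have "((\<lambda>v. \<rho> 0 * \<phi> (v, \<rho> 0)) has_real_derivative \<rho> 0 * g') (at v)"
    by (intro DERIV_cmult) simp
  moreover have "a v v + b v v = \<rho> 0 * g'"
  proof -
    have "blinfun_apply (G (v, \<rho> 0)) ((0, - f 0) + (1, f 0))
        = blinfun_apply (G (v, \<rho> 0)) (0, - f 0) + blinfun_apply (G (v, \<rho> 0)) (1, f 0)"
      by (rule blinfun.add_right)
    then show ?thesis
      unfolding a_def b_def \<phi>u_def \<phi>v_def p_def g'_def by (simp add: distrib_left)
  qed
  ultimately show ?thesis by (simp add: \<psi>_def p_def)
qed

text \<open>On [v, 2v] the mean value theorem finds a point where the diagonal derivative is bounded
  by a multiple of \<open>w v\<close>. A nonzero limit would make it at least of order 1 / R^3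
  there, which is too large as v tends to infinity.\<close>

lemma frakL_zero: "frakL M e U0 \<phi> = 0"
proof (rule ccontr)
  define L where "L = frakL M e U0 \<phi>"
  assume "frakL M e U0 \<phi> \<noteq> 0"
  then have L: "L \<noteq> 0" by (simp add: L_def)
  obtain K where K: "0 < K" "\<And>u v. - U0 \<le> u \<Longrightarrow> 1 \<le> v \<Longrightarrow> \<bar>\<psi> u v\<bar> \<le> K * \<rho> (v - u) * w (min u v)"
    by (rule psi_decay) blast
  obtain K1 where K1: "0 \<le> K1" "\<And>u v. - U0 \<le> u \<Longrightarrow> u \<le> v \<Longrightarrow> 1 \<le> v \<Longrightarrow> \<bar>a u v\<bar> \<le> K1 * w u"
    by (rule a_decay) blast
  have "((\<lambda>v. R v ^ 3 * a v v) \<longlongrightarrow> 0) at_top"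
  proof (rule R_cube_zero[OF _ K1(1)])
    fix v :: real assume v: "2 \<le> v"
    have "\<bar>a v v\<bar> \<le> K1 * w v" using v U0_pos by (intro K1) auto
    also have "\<dots> \<le> K1 * w (v / 2)" using v U0_pos K1(1) by (intro mult_left_mono w_mono) auto
    finally show "\<bar>a v v\<bar> \<le> K1 * w (v / 2)" .
  qed
  from tendsto_add[OF this b_diagonal_limit]
  have "((\<lambda>v. \<bar>R v ^ 3 * (a v v + b v v)\<bar>) \<longlongrightarrow> \<bar>L\<bar>) at_top"
    by (intro tendsto_rabs) (simp add: L_def distrib_left)
  moreover have "\<bar>L\<bar> / 2 < \<bar>L\<bar>" using L by simp
  ultimately have "\<forall>\<^sub>F v in at_top. \<bar>L\<bar> / 2 < \<bar>R v ^ 3 * (a v v + b v v)\<bar>" by (rule order_tendstoD)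
  then obtain v0 where v0: "\<And>v. v0 \<le> v \<Longrightarrow> \<bar>L\<bar> / 2 < \<bar>R v ^ 3 * (a v v + b v v)\<bar>"
    by (auto simp: eventually_at_top_linorder)
  define A where "A = \<rho> 0 + U0"
  have A: "0 \<le> A" using rho_pos[of 0] U0_pos by (simp add: A_def)
  have key: "\<bar>L\<bar> / 2 \<le> 2 * K * \<rho> 0 * ((A + 2 * v) ^ 3 * w v)" if v: "v0 \<le> v" "2 \<le> v" for v
  proof -
    have "\<exists>\<xi>. v < \<xi> \<and> \<xi> < 2 * v \<and> \<psi> (2 * v) (2 * v) - \<psi> v v = (2 * v - v) * (a \<xi> \<xi> + b \<xi> \<xi>)"
      by (rule MVT2) (use v in \<open>auto intro: psi_diagonal_deriv\<close>)
    then obtain \<xi> where \<xi>: "v < \<xi>" "\<xi> < 2 * v" "\<psi> (2 * v) (2 * v) - \<psi> v v = (2 * v - v) * (a \<xi> \<xi> + b \<xi> \<xi>)"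
      by blast
    have diag: "\<bar>\<psi> x x\<bar> \<le> K * \<rho> 0 * w v" if "v \<le> x" for x
    proof -
      have "\<bar>\<psi> x x\<bar> \<le> K * \<rho> 0 * w x" using K(2)[of x x] that v U0_pos by simp
      also have "\<dots> \<le> K * \<rho> 0 * w v"
        using that v U0_pos K(1) rho_pos[of 0] by (intro mult_left_mono w_mono) auto
      finally show ?thesis .
    qed
    \<comment> \<open>Of the length v of the interval only v \<ge> 1 is kept; the weight alone beats
      the cube since \<alpha> > 3.\<close>
    have "1 * \<bar>a \<xi> \<xi> + b \<xi> \<xi>\<bar> \<le> v * \<bar>a \<xi> \<xi> + b \<xi> \<xi>\<bar>" using v by (intro mult_right_mono) auto
    also have "\<dots> = \<bar>\<psi> (2 * v) (2 * v) - \<psi> v v\<bar>" using \<xi>(3) v by (simp add: abs_mult)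
    also have "\<dots> \<le> 2 * K * \<rho> 0 * w v" using diag[of v] diag[of "2 * v"] v by simp
    finally have d: "\<bar>a \<xi> \<xi> + b \<xi> \<xi>\<bar> \<le> 2 * K * \<rho> 0 * w v" by simp
    have "R \<xi> \<le> A + 2 * v" using R_le_linear[of \<xi>] \<xi> v by (simp add: A_def)
    then have "R \<xi> ^ 3 \<le> (A + 2 * v) ^ 3" using rho_pos[of "\<xi> + U0"] by (intro power_mono) auto
    then have "\<bar>R \<xi> ^ 3 * (a \<xi> \<xi> + b \<xi> \<xi>)\<bar> \<le> (A + 2 * v) ^ 3 * (2 * K * \<rho> 0 * w v)"
      unfolding abs_mult using rho_pos[of "\<xi> + U0"] d A v by (intro mult_mono) auto
    then show ?thesis using v0[of \<xi>] \<xi> v by (simp add: mult_ac)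
  qed
  have "filterlim (\<lambda>v::real. 2 * v) at_top at_top"
    by (intro filterlim_tendsto_pos_mult_at_top[OF tendsto_const] filterlim_ident) auto
  from filterlim_compose[OF cubic_weight_zero[OF A] this]
  have "((\<lambda>v. (A + 2 * v) ^ 3 * w v) \<longlongrightarrow> 0) at_top" by simp
  then have "((\<lambda>v. 2 * K * \<rho> 0 * ((A + 2 * v) ^ 3 * w v)) \<longlongrightarrow> 0) at_top" by (rule tendsto_mult_right_zero)
  then have "\<bar>L\<bar> / 2 \<le> 0"
    by (rule tendsto_lowerbound)
       (use eventually_ge_at_top[of "max v0 2"] in \<open>eventually_elim, use key in auto\<close>)
  then show False using L by simp
qed

end

section \<open>Fixing the constants and closing the contradiction\<close>

theorem corollary1p9:
  fixes M e U0 :: real and \<phi> :: "real \<times> real \<Rightarrow> real"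
  assumes "0 < \<bar>e\<bar>" and "\<bar>e\<bar> < M" and "0 < U0"
    and "wave_solution M e U0 \<phi>"
    and "\<exists>D>0. data_bounds M e U0 \<phi> D"
    and "limit_condition M e U0 \<phi>"
    and "frakL M e U0 \<phi> \<noteq> 0"
  shows "\<forall>\<epsilon>>0. (\<integral>\<^sup>+v\<in>{1..}. ennreal (v powr (7 + \<epsilon>) * (d_v_horizon M e \<phi> v)\<^sup>2) \<partial>lborel) = \<infinity>"
proof (intro allI impI, rule ccontr)
  fix \<epsilon> :: real
  assume \<epsilon>: "0 < \<epsilon>"
    and fin: "(\<integral>\<^sup>+v\<in>{1..}. ennreal (v powr (7 + \<epsilon>) * (d_v_horizon M e \<phi> v)\<^sup>2) \<partial>lborel) \<noteq> \<infinity>"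
  define \<alpha> where "\<alpha> = 3 + \<epsilon> / 2"
  have \<alpha>: "7 + \<epsilon> = 2 * \<alpha> + 1" "3 < \<alpha>" using \<epsilon> by (auto simp: \<alpha>_def)
  obtain D where D: "data_bounds M e U0 \<phi> D" using assms(5) by blast
  obtain G where G: "\<And>q. q \<in> region M e U0 \<Longrightarrow> (\<phi> has_derivative blinfun_apply (G q)) (at q within region M e U0)"
      "continuous_on (region M e U0) G"
    using assms(4) unfolding wave_solution_def C1_on_def by blast
  interpret horizon_wave M e U0 D \<phi> G
    by unfold_locales (use assms D G in \<open>auto simp: wave_solution_def\<close>)
  obtain \<phi>\<^sub>0 C0 where decay: "\<And>v. 1 \<le> v \<Longrightarrow> \<bar>\<phi>H v - \<phi>\<^sub>0\<bar> \<le> C0 * v powr - \<alpha>"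
    by (rule horizon_decay_of_finite_integral[OF _ fin[unfolded \<alpha>(1)]]) (use \<alpha> in auto)
  obtain k where k: "k > 0" "\<And>x. x \<le> 0 \<Longrightarrow> k * f x \<le> f' x" "\<And>x. x \<le> 0 \<Longrightarrow> k * (\<rho> x - rp) \<le> f x"
    by (rule redshift) blast
  \<comment> \<open>The equality case of \<open>c_le\<close>.\<close>
  define c where "c = rp / (2 * (\<rho> 0 - rp))"
  have c: "0 < c" "c * (\<rho> 0 - rp) \<le> rp / 2"
    using rp_pos rho_gt[of 0] by (auto simp: c_def field_simps)
  \<comment> \<open>\<open>k\<close> depends on the geometry alone and \<open>c\<close> is fixed
    before \<open>T\<close>, so \<open>T\<close> can be a sum of nonnegative terms that meets all
    three lower bounds at once.\<close>
  define T where "T = 1 + U0 + (1 + c) * \<alpha> / (c * k) + \<alpha> / k"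
  have nonneg: "0 \<le> (1 + c) * \<alpha> / (c * k)" "0 \<le> \<alpha> / k" using c k \<alpha> by auto
  have "(1 + c) * \<alpha> / (c * k) \<le> 1 + T" "\<alpha> / k \<le> 1 + T" "1 + U0 \<le> T"
    using nonneg assms(3) by (auto simp: T_def)
  then have T: "1 + U0 \<le> T" "(1 + c) * \<alpha> \<le> c * k * (1 + T)" "\<alpha> \<le> k * (1 + T)"
    using c k by (simp_all add: pos_divide_le_eq mult.commute)
  interpret horizon_decay M e U0 D \<phi> G \<alpha> \<phi>\<^sub>0 C0 k c T
    by unfold_locales (use \<alpha> decay k c T in auto)
  show False using frakL_zero assms(7) by simp
qed

end
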